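(* For the solutions $\mathbf{E}^{t_{end}},\mathbf{H}^{t_{end}}$ given by the fully discrete scheme defined in the context, two discrete helicity conservation laws hold: $$\mathcal{H}_1^{t_{end}}=\mathcal{H}_1^0,\qquad \mathcal{H}_2^{t_{end}}=\mathcal{H}_2^0,$$ where $$\mathcal{H}_1^t=\tfrac1{2\varepsilon}\langle\mathbf{H}^t,\mathbf{D}\mathbf{H}^t\rangle_N+\tfrac1{2\mu}\langle\mathbf{E}^t,\mathbf{D}\mathbf{E}^t\rangle_N,$$ $$\mathcal{H}_2^t=\tfrac1{2\varepsilon}\Big\langle\tfrac{d}{dt}\mathbf{H}^t,\mathbf{D}\tfrac{d}{dt}\mathbf{H}^t\Big\rangle_N+\tfrac1{2\mu}\Big\langle\tfrac{d}{dt}\mathbf{E}^t,\mathbf{D}\tfrac{d}{dt}\mathbf{E}^t\Big\rangle_N.$$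
   Context: **Setting.** $\varepsilon,\mu>0$ are constants. The scheme approximates Maxwell's equations $\partial_t\mathbf{H}=-\frac1\mu\mathbf{curl}\,\mathbf{E}$, $\partial_t\mathbf{E}=\frac1\varepsilon\mathbf{curl}\,\mathbf{H}$, $\nabla\cdot(\varepsilon\mathbf{E})=0$, $\nabla\cdot(\varepsilon\mathbf{H})=0$ for $\mathbb{R}^3$-valued $\mathbf{H}=(H_x,H_y,H_z)^\intercal$, $\mathbf{E}=(E_x,E_y,E_z)^\intercal$ on $\Omega\times[0,t_{end}]$, $\Omega=[x_L,x_R]\times[y_L,y_R]\times[z_L,z_R]$, with periodic boundary conditions and given initial values. **Grid.** For $w\in\{x,y,z\}$, $N_w$ is a positive even integer, $h_w=(w_R-w_L)/N_w$, $x_j=x_L+(j-1)h_x$, $y_k=y_L+(k-1)h_y$, $z_l=z_L+(l-1)h_z$ for $1\le j\le N_x$, $1\le k\le N_y$, $1\le l\le N_z$. A grid function is identified with the vector in $\mathbb{C}^{N_xN_yN_z}$ whose entry number $N_xN_y(l-1)+N_x(k-1)+j$ is its value at $(x_j,y_k,z_l)$. $I_m$ is the $m\times m$ identity and $\otimes$ the Kronecker product. $\langle u,v\rangle_N=\frac1{N_xN_yN_z}\sum_{j,k,l}u_{j,k,l}\overline{v_{j,k,l}}$, summed over the three components for vector fields. **Matrices.** $\nu_w=2\pi/(w_R-w_L)$. $D_w$ is the $N_w\times N_w$ spectral differentiation matrix with $(D_w)_{j,l}=\frac12\nu_w(-1)^{j+l}\cot(\nu_w(w_j-w_l)/2)$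 for $j\ne l$ and zero diagonal, and $$\mathbf{D}=\begin{pmatrix} \mathbf{0} & -D_z\otimes I_{N_y}\otimes I_{N_x} & I_{N_z}\otimes D_y\otimes I_{N_x} \\ D_z\otimes I_{N_y}\otimes I_{N_x} & \mathbf{0} & -I_{N_z}\otimes I_{N_y}\otimes D_x \\ -I_{N_z}\otimes D_y\otimes I_{N_x} & I_{N_z}\otimes I_{N_y}\otimes D_x & \mathbf{0} \end{pmatrix}.$$ $\mathcal{F}_{N_w}$ is the DFT matrix with entries $(e^{2\pi\mathrm{i}/N_w})^{-jk}$, $0\le j,k\le N_w-1$, and $\mathcal{F}_{N_w}^{-1}$ its inverse, with entries $\frac1{N_w}(e^{2\pi\mathrm{i}/N_w})^{jk}$. Put $\Omega_w=\nu_w\,\mathrm{diag}(0,1,\ldots,\frac{N_w}2-1,0,-\frac{N_w}2+1,\ldots,-2,-1)$, $\Omega_1=I_{N_z}\otimes I_{N_y}\otimes\Omega_x$, $\Omega_2=I_{N_z}\otimes\Omega_y\otimes I_{N_x}$, $\Omega_3=\Omega_z\otimes I_{N_y}\otimes I_{N_x}$. For $\tau\ge0$ put $\Psi=\tau^2(\Omega_1^2+\Omega_2^2+\Omega_3^2)$ and let $A=\frac{\cosh(\sqrt{-\Psi})-I}{\Psi}$, $B=\frac{\sinh(\sqrt{-\Psi})}{\sqrt{-\Psi}}$ be the diagonal matrices obtained entrywise (with the value by continuity, $-1/2$ and $1$ respectively, where the diagonal entry of $\Psi$ is $0$). Define $\mathbf{c}_{11}=I+\tau^2(\Omega_3^2+\Omega_2^2)A$,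 $\mathbf{c}_{22}=I+\tau^2(\Omega_3^2+\Omega_1^2)A$, $\mathbf{c}_{33}=I+\tau^2(\Omega_2^2+\Omega_1^2)A$, $\mathbf{c}_{12}=-\tau^2\Omega_2\Omega_1A$, $\mathbf{c}_{13}=-\tau^2\Omega_3\Omega_1A$, $\mathbf{c}_{23}=-\tau^2\Omega_3\Omega_2A$, $\mathbf{s}_{12}=\mathrm{i}\tau\Omega_3B$, $\mathbf{s}_{13}=\mathrm{i}\tau\Omega_2B$, $\mathbf{s}_{23}=\mathrm{i}\tau\Omega_1B$. **Fully discrete scheme.** Let $\mathbf{E}^0_w,\mathbf{H}^0_w$ be the (real) vectors of values of $E_w(\cdot,0),H_w(\cdot,0)$ at the grid points, and $\widehat{\mathbf{E}}^0_w=(\mathcal{F}_{N_z}\otimes\mathcal{F}_{N_y}\otimes\mathcal{F}_{N_x})\mathbf{E}^0_w$, $\widehat{\mathbf{H}}^0_w=(\mathcal{F}_{N_z}\otimes\mathcal{F}_{N_y}\otimes\mathcal{F}_{N_x})\mathbf{H}^0_w$. For a time $t\ge0$, with $\tau=t/\sqrt{\mu\varepsilon}$, $$\mathbf{c}=\begin{pmatrix} \mathbf{c}_{11} & \mathbf{c}_{12} & \mathbf{c}_{13} \\ \mathbf{c}_{12} & \mathbf{c}_{22} & \mathbf{c}_{23} \\ \mathbf{c}_{13} & \mathbf{c}_{23} & \mathbf{c}_{33} \end{pmatrix},\qquad \mathbf{s}=\begin{pmatrix} \mathbf{0} & -\mathbf{s}_{12} & \mathbf{s}_{13} \\ \mathbf{s}_{12}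 & \mathbf{0} & -\mathbf{s}_{23} \\ -\mathbf{s}_{13} & \mathbf{s}_{23} & \mathbf{0} \end{pmatrix},$$ and $\widehat{\mathbf{E}}=(\widehat{\mathbf{E}}_x,\widehat{\mathbf{E}}_y,\widehat{\mathbf{E}}_z)^\intercal$, $\widehat{\mathbf{H}}=(\widehat{\mathbf{H}}_x,\widehat{\mathbf{H}}_y,\widehat{\mathbf{H}}_z)^\intercal$ (stacked), set $$\sqrt\mu\,\widehat{\mathbf{H}}^{t}=\sqrt\mu\,\mathbf{c}\,\widehat{\mathbf{H}}^0-\sqrt\varepsilon\,\mathbf{s}\,\widehat{\mathbf{E}}^0,\qquad \sqrt\varepsilon\,\widehat{\mathbf{E}}^{t}=\sqrt\varepsilon\,\mathbf{c}\,\widehat{\mathbf{E}}^0+\sqrt\mu\,\mathbf{s}\,\widehat{\mathbf{H}}^0,$$ $\mathbf{E}^{t}_w=(\mathcal{F}^{-1}_{N_z}\otimes\mathcal{F}^{-1}_{N_y}\otimes\mathcal{F}^{-1}_{N_x})\widehat{\mathbf{E}}^{t}_w$, $\mathbf{H}^{t}_w=(\mathcal{F}^{-1}_{N_z}\otimes\mathcal{F}^{-1}_{N_y}\otimes\mathcal{F}^{-1}_{N_x})\widehat{\mathbf{H}}^{t}_w$ for $w=x,y,z$, and $\mathbf{E}^t=(\mathbf{E}^t_x,\mathbf{E}^t_y,\mathbf{E}^t_z)^\intercal$, $\mathbf{H}^t=(\mathbf{H}^t_x,\mathbf{H}^t_y,\mathbf{H}^t_z)^\intercal$. The scheme's output is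 the case $t=t_{end}$; $\frac{d}{dt}\mathbf{E}^t,\frac{d}{dt}\mathbf{H}^t$ denote derivatives of these vector functions of $t$. *)

theory Defs
  imports "HOL-Analysis.Derivative" "Jordan_Normal_Form.Matrix"
begin

unbundle no vec_syntax  (* \<open>$\<close> is indexing of Jordan_Normal_Form vectors below *)
no_notation inner (infix "\<bullet>" 70)

text \<open>
  All vectors and matrices are those of Jordan_Normal_Form and are indexed from 0, so the entry
  with 1-based index \<open>j\<close> of the usual notation is the entry \<open>j - 1\<close> here.  The box is the product
  over the three directions \<open>w\<close> of the intervals from \<open>L w\<close> to \<open>R w\<close>, with \<open>N w\<close> grid points each.
\<close>

datatype axis = xdir | ydir | zdir


section \<open>Kronecker products, block matrices, stacked vectors\<close>

definition kron :: "'a::semiring_0 mat \<Rightarrow> 'a mat \<Rightarrow> 'a mat" where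
  "kron A B = mat (dim_row A * dim_row B) (dim_col A * dim_col B)
     (\<lambda>(i, j). A $$ (i div dim_row B, j div dim_col B) * B $$ (i mod dim_row B, j mod dim_col B))"

text \<open>The \<open>3n \<times> 3n\<close> matrix with \<open>n \<times> n\<close> blocks, given as a list of block rows.\<close>
definition block3 :: "nat \<Rightarrow> 'a mat list list \<Rightarrow> 'a mat" where
  "block3 n bs = mat (3 * n) (3 * n)
     (\<lambda>(i, j). (bs ! (i div n) ! (j div n)) $$ (i mod n, j mod n))"

definition stack3 :: "(axis \<Rightarrow> 'a vec) \<Rightarrow> 'a vec" where
  "stack3 u = u xdir @\<^sub>v u ydir @\<^sub>v u zdir"

fun axis_index :: "axis \<Rightarrow> nat" where
  "axis_index xdir = 0"
| "axis_index ydir = 1"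
| "axis_index zdir = 2"

definition comp3 :: "nat \<Rightarrow> 'a vec \<Rightarrow> axis \<Rightarrow> 'a vec" where
  "comp3 n v w = vec n (\<lambda>i. v $ (axis_index w * n + i))"


section \<open>Grid\<close>

definition npts :: "(axis \<Rightarrow> nat) \<Rightarrow> nat" where
  "npts N = N xdir * N ydir * N zdir"

definition grid_pt :: "(axis \<Rightarrow> nat) \<Rightarrow> (axis \<Rightarrow> real) \<Rightarrow> (axis \<Rightarrow> real) \<Rightarrow> axis \<Rightarrow> nat \<Rightarrow> real" where
  "grid_pt N L R w j = L w + real j * ((R w - L w) / real (N w))"

definition grid_fun :: "(axis \<Rightarrow> nat) \<Rightarrow> (axis \<Rightarrow> real) \<Rightarrow> (axis \<Rightarrow> real) \<Rightarrow>
    (real \<Rightarrow> real \<Rightarrow> real \<Rightarrow> real) \<Rightarrow> complex vec" where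
  "grid_fun N L R u = vec (npts N) (\<lambda>i. complex_of_real
     (u (grid_pt N L R xdir (i mod N xdir))
        (grid_pt N L R ydir ((i div N xdir) mod N ydir))
        (grid_pt N L R zdir (i div (N xdir * N ydir)))))"

text \<open>For a stacked field the sum over all entries is the sum over grid points and components.\<close>
definition inner_N :: "(axis \<Rightarrow> nat) \<Rightarrow> complex vec \<Rightarrow> complex vec \<Rightarrow> complex" where
  "inner_N N u v = 1 / of_nat (npts N) * (u \<bullet>c v)"


section \<open>Spectral differentiation and discrete Fourier transform\<close>

definition nu :: "(axis \<Rightarrow> real) \<Rightarrow> (axis \<Rightarrow> real) \<Rightarrow> axis \<Rightarrow> real" where
  "nu L R w = 2 * pi / (R w - L w)"

definition diff_mat :: "(axis \<Rightarrow> nat) \<Rightarrow> (axis \<Rightarrow> real) \<Rightarrow> (axis \<Rightarrow> real) \<Rightarrow> axis \<Rightarrow> complex mat" where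
  "diff_mat N L R w = mat (N w) (N w) (\<lambda>(j, l). complex_of_real
     (if j = l then 0
      else 1 / 2 * nu L R w * (-1) ^ (j + l)
           * cot (nu L R w * (grid_pt N L R w j - grid_pt N L R w l) / 2)))"

definition lift_axis :: "(axis \<Rightarrow> nat) \<Rightarrow> axis \<Rightarrow> complex mat \<Rightarrow> complex mat" where
  "lift_axis N w M = (case w of
     xdir \<Rightarrow> kron (1\<^sub>m (N zdir)) (kron (1\<^sub>m (N ydir)) M)
   | ydir \<Rightarrow> kron (1\<^sub>m (N zdir)) (kron M (1\<^sub>m (N xdir)))
   | zdir \<Rightarrow> kron M (kron (1\<^sub>m (N ydir)) (1\<^sub>m (N xdir))))"

definition curl_mat :: "(axis \<Rightarrow> nat) \<Rightarrow> (axis \<Rightarrow> real) \<Rightarrow> (axis \<Rightarrow> real) \<Rightarrow> complex mat" where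
  "curl_mat N L R =
    (let n = npts N; Z = 0\<^sub>m n n; D = (\<lambda>w. lift_axis N w (diff_mat N L R w)) in
     block3 n
      [[Z, - D zdir, D ydir],
       [D zdir, Z, - D xdir],
       [- D ydir, D xdir, Z]])"

definition dft :: "nat \<Rightarrow> complex mat" where
  "dft m = mat m m (\<lambda>(j, k). inverse (exp (2 * of_real pi * \<i> / of_nat m) ^ (j * k)))"

definition idft :: "nat \<Rightarrow> complex mat" where
  "idft m = mat m m (\<lambda>(j, k). 1 / of_nat m * exp (2 * of_real pi * \<i> / of_nat m) ^ (j * k))"

definition dft3 :: "(axis \<Rightarrow> nat) \<Rightarrow> complex mat" where
  "dft3 N = kron (dft (N zdir)) (kron (dft (N ydir)) (dft (N xdir)))"

definition idft3 :: "(axis \<Rightarrow> nat) \<Rightarrow> complex mat" where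
  "idft3 N = kron (idft (N zdir)) (kron (idft (N ydir)) (idft (N xdir)))"

text \<open>The diagonal is \<open>0, 1, \<dots>, m/2 - 1, 0, -m/2 + 1, \<dots>, -1\<close> times \<open>\<nu>\<close>, with \<open>m = N w\<close>.\<close>
definition freq_mat :: "(axis \<Rightarrow> nat) \<Rightarrow> (axis \<Rightarrow> real) \<Rightarrow> (axis \<Rightarrow> real) \<Rightarrow> axis \<Rightarrow> complex mat" where
  "freq_mat N L R w = complex_of_real (nu L R w) \<cdot>\<^sub>m mat_diag (N w) (\<lambda>j.
     if j < N w div 2 then of_nat j
     else if j = N w div 2 then 0
     else of_nat j - of_nat (N w))"

text \<open>\<open>Om N L R xdir\<close>, \<open>Om N L R ydir\<close>, \<open>Om N L R zdir\<close> are \<open>\<Omega>\<^sub>1\<close>, \<open>\<Omega>\<^sub>2\<close>, \<open>\<Omega>\<^sub>3\<close>.\<close>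
definition Om :: "(axis \<Rightarrow> nat) \<Rightarrow> (axis \<Rightarrow> real) \<Rightarrow> (axis \<Rightarrow> real) \<Rightarrow> axis \<Rightarrow> complex mat" where
  "Om N L R w = lift_axis N w (freq_mat N L R w)"


section \<open>Propagator in Fourier space\<close>

definition Psi_mat :: "(axis \<Rightarrow> nat) \<Rightarrow> (axis \<Rightarrow> real) \<Rightarrow> (axis \<Rightarrow> real) \<Rightarrow> real \<Rightarrow> complex mat" where
  "Psi_mat N L R \<tau> = complex_of_real (\<tau>\<^sup>2) \<cdot>\<^sub>m
     (Om N L R xdir ^\<^sub>m 2 + Om N L R ydir ^\<^sub>m 2 + Om N L R zdir ^\<^sub>m 2)"

text \<open>
  Diagonal functions of \<open>\<Psi>\<close>.  Both are even in the square root, so the choice of branch of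
  \<^const>\<open>csqrt\<close> does not matter; the values at 0 are the continuous extensions.
\<close>
definition A_mat :: "(axis \<Rightarrow> nat) \<Rightarrow> (axis \<Rightarrow> real) \<Rightarrow> (axis \<Rightarrow> real) \<Rightarrow> real \<Rightarrow> complex mat" where
  "A_mat N L R \<tau> = mat_diag (npts N) (\<lambda>i. let \<psi> = Psi_mat N L R \<tau> $$ (i, i) in
     if \<psi> = 0 then - 1 / 2 else (cosh (csqrt (- \<psi>)) - 1) / \<psi>)"

definition B_mat :: "(axis \<Rightarrow> nat) \<Rightarrow> (axis \<Rightarrow> real) \<Rightarrow> (axis \<Rightarrow> real) \<Rightarrow> real \<Rightarrow> complex mat" where
  "B_mat N L R \<tau> = mat_diag (npts N) (\<lambda>i. let \<psi> = Psi_mat N L R \<tau> $$ (i, i) in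
     if \<psi> = 0 then 1 else sinh (csqrt (- \<psi>)) / csqrt (- \<psi>))"

definition c_mat :: "(axis \<Rightarrow> nat) \<Rightarrow> (axis \<Rightarrow> real) \<Rightarrow> (axis \<Rightarrow> real) \<Rightarrow> real \<Rightarrow> complex mat" where
  "c_mat N L R \<tau> =
    (let n = npts N; t2 = complex_of_real (\<tau>\<^sup>2); A = A_mat N L R \<tau>;
         O1 = Om N L R xdir; O2 = Om N L R ydir; O3 = Om N L R zdir;
         c11 = 1\<^sub>m n + t2 \<cdot>\<^sub>m ((O3 ^\<^sub>m 2 + O2 ^\<^sub>m 2) * A);
         c22 = 1\<^sub>m n + t2 \<cdot>\<^sub>m ((O3 ^\<^sub>m 2 + O1 ^\<^sub>m 2) * A);
         c33 = 1\<^sub>m n + t2 \<cdot>\<^sub>m ((O2 ^\<^sub>m 2 + O1 ^\<^sub>m 2) * A);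
         c12 = (- t2) \<cdot>\<^sub>m (O2 * O1 * A);
         c13 = (- t2) \<cdot>\<^sub>m (O3 * O1 * A);
         c23 = (- t2) \<cdot>\<^sub>m (O3 * O2 * A)
     in block3 n
      [[c11, c12, c13],
       [c12, c22, c23],
       [c13, c23, c33]])"

definition s_mat :: "(axis \<Rightarrow> nat) \<Rightarrow> (axis \<Rightarrow> real) \<Rightarrow> (axis \<Rightarrow> real) \<Rightarrow> real \<Rightarrow> complex mat" where
  "s_mat N L R \<tau> =
    (let n = npts N; Z = 0\<^sub>m n n; it = \<i> * complex_of_real \<tau>; B = B_mat N L R \<tau>;
         s12 = it \<cdot>\<^sub>m (Om N L R zdir * B);
         s13 = it \<cdot>\<^sub>m (Om N L R ydir * B);
         s23 = it \<cdot>\<^sub>m (Om N L R xdir * B)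
     in block3 n
      [[Z, - s12, s13],
       [s12, Z, - s23],
       [- s13, s23, Z]])"


section \<open>The fully discrete scheme\<close>

text \<open>The initial fields \<open>E0\<close> and \<open>H0\<close> give, for each component, its values at time 0.\<close>

type_synonym init_field = "axis \<Rightarrow> real \<Rightarrow> real \<Rightarrow> real \<Rightarrow> real"

definition hat0 :: "(axis \<Rightarrow> nat) \<Rightarrow> (axis \<Rightarrow> real) \<Rightarrow> (axis \<Rightarrow> real) \<Rightarrow> init_field \<Rightarrow> complex vec" where
  "hat0 N L R F0 = stack3 (\<lambda>w. dft3 N *\<^sub>v grid_fun N L R (F0 w))"

definition H_hat :: "(axis \<Rightarrow> nat) \<Rightarrow> (axis \<Rightarrow> real) \<Rightarrow> (axis \<Rightarrow> real) \<Rightarrow> real \<Rightarrow> real \<Rightarrow>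
    init_field \<Rightarrow> init_field \<Rightarrow> real \<Rightarrow> complex vec" where
  "H_hat N L R \<epsilon> \<mu> E0 H0 t = (let \<tau> = t / sqrt (\<mu> * \<epsilon>) in
     complex_of_real (1 / sqrt \<mu>) \<cdot>\<^sub>v
      (complex_of_real (sqrt \<mu>) \<cdot>\<^sub>v (c_mat N L R \<tau> *\<^sub>v hat0 N L R H0)
       - complex_of_real (sqrt \<epsilon>) \<cdot>\<^sub>v (s_mat N L R \<tau> *\<^sub>v hat0 N L R E0)))"

definition E_hat :: "(axis \<Rightarrow> nat) \<Rightarrow> (axis \<Rightarrow> real) \<Rightarrow> (axis \<Rightarrow> real) \<Rightarrow> real \<Rightarrow> real \<Rightarrow>
    init_field \<Rightarrow> init_field \<Rightarrow> real \<Rightarrow> complex vec" where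
  "E_hat N L R \<epsilon> \<mu> E0 H0 t = (let \<tau> = t / sqrt (\<mu> * \<epsilon>) in
     complex_of_real (1 / sqrt \<epsilon>) \<cdot>\<^sub>v
      (complex_of_real (sqrt \<epsilon>) \<cdot>\<^sub>v (c_mat N L R \<tau> *\<^sub>v hat0 N L R E0)
       + complex_of_real (sqrt \<mu>) \<cdot>\<^sub>v (s_mat N L R \<tau> *\<^sub>v hat0 N L R H0)))"

definition H_sol :: "(axis \<Rightarrow> nat) \<Rightarrow> (axis \<Rightarrow> real) \<Rightarrow> (axis \<Rightarrow> real) \<Rightarrow> real \<Rightarrow> real \<Rightarrow>
    init_field \<Rightarrow> init_field \<Rightarrow> real \<Rightarrow> complex vec" where
  "H_sol N L R \<epsilon> \<mu> E0 H0 t =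
     stack3 (\<lambda>w. idft3 N *\<^sub>v comp3 (npts N) (H_hat N L R \<epsilon> \<mu> E0 H0 t) w)"

definition E_sol :: "(axis \<Rightarrow> nat) \<Rightarrow> (axis \<Rightarrow> real) \<Rightarrow> (axis \<Rightarrow> real) \<Rightarrow> real \<Rightarrow> real \<Rightarrow>
    init_field \<Rightarrow> init_field \<Rightarrow> real \<Rightarrow> complex vec" where
  "E_sol N L R \<epsilon> \<mu> E0 H0 t =
     stack3 (\<lambda>w. idft3 N *\<^sub>v comp3 (npts N) (E_hat N L R \<epsilon> \<mu> E0 H0 t) w)"


section \<open>Helicities\<close>

text \<open>
  Entrywise time derivative.  The scheme is defined for nonnegative times, so the derivative is
  taken within \<open>{0..}\<close>: one-sided at time 0 and the ordinary derivative at positive times.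
\<close>
definition time_deriv :: "(real \<Rightarrow> complex vec) \<Rightarrow> real \<Rightarrow> complex vec" where
  "time_deriv u t =
     vec (dim_vec (u t)) (\<lambda>i. vector_derivative (\<lambda>r. u r $ i) (at t within {0..}))"

definition helicity :: "(axis \<Rightarrow> nat) \<Rightarrow> (axis \<Rightarrow> real) \<Rightarrow> (axis \<Rightarrow> real) \<Rightarrow> real \<Rightarrow> real \<Rightarrow>
    complex vec \<Rightarrow> complex vec \<Rightarrow> complex" where
  "helicity N L R \<epsilon> \<mu> E H =
     complex_of_real (1 / (2 * \<epsilon>)) * inner_N N H (curl_mat N L R *\<^sub>v H)
     + complex_of_real (1 / (2 * \<mu>)) * inner_N N E (curl_mat N L R *\<^sub>v E)"

definition helicity1 :: "(axis \<Rightarrow> nat) \<Rightarrow> (axis \<Rightarrow> real) \<Rightarrow> (axis \<Rightarrow> real) \<Rightarrow> real \<Rightarrow> real \<Rightarrow>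
    init_field \<Rightarrow> init_field \<Rightarrow> real \<Rightarrow> complex" where
  "helicity1 N L R \<epsilon> \<mu> E0 H0 t =
     helicity N L R \<epsilon> \<mu> (E_sol N L R \<epsilon> \<mu> E0 H0 t) (H_sol N L R \<epsilon> \<mu> E0 H0 t)"

definition helicity2 :: "(axis \<Rightarrow> nat) \<Rightarrow> (axis \<Rightarrow> real) \<Rightarrow> (axis \<Rightarrow> real) \<Rightarrow> real \<Rightarrow> real \<Rightarrow>
    init_field \<Rightarrow> init_field \<Rightarrow> real \<Rightarrow> complex" where
  "helicity2 N L R \<epsilon> \<mu> E0 H0 t =
     helicity N L R \<epsilon> \<mu> (time_deriv (E_sol N L R \<epsilon> \<mu> E0 H0) t)
       (time_deriv (H_sol N L R \<epsilon> \<mu> E0 H0) t)"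

end

theory Submission
  imports Defs
begin

text \<open>
  The discrete Fourier transform diagonalizes the spectral differentiation matrices and is unitary up
  to a factor, so both helicities are sums over the Fourier modes of
  \<open>\<langle>H, K H\<rangle> / (2 \<epsilon>) + \<langle>E, K E\<rangle> / (2 \<mu>)\<close>, where \<open>K v = \<i> \<omega> \<times> v\<close> is Hermitian.  On each mode the scheme
  rotates the pair \<open>(\<surd>\<mu> H, \<surd>\<epsilon> E)\<close> by the commuting Hermitian matrices \<open>cos (\<tau> K)\<close> and \<open>sin (\<tau> K)\<close>,
  which leaves this quantity unchanged.  Since \<open>H' = - K E / \<mu>\<close> and \<open>E' = K H / \<epsilon>\<close>, the second helicity
  is, up to a factor, the first one for the solution with initial data \<open>K H\<close> and \<open>K E\<close>.
\<close>


section \<open>Kronecker products, diagonal and block matrices\<close>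

text \<open>Division with remainder cuts the range into \<open>a\<close> consecutive blocks of
  length \<open>b\<close>. This splits the flattened indices of \<open>kron\<close> and
  \<open>block3\<close> in matrix products.\<close>

lemma sum_lessThan_mult:
  fixes f :: "nat \<Rightarrow> nat \<Rightarrow> 'a::comm_monoid_add"
  shows "(\<Sum>k<a * b. f (k div b) (k mod b)) = (\<Sum>i<a. \<Sum>j<b. f i j)"
proof (cases "b = 0")
  case False
  have "(\<Sum>k<a * b. f (k div b) (k mod b)) =
      (\<Sum>i<a. sum (\<lambda>k. f (k div b) (k mod b)) {i * b..<i * b + b})"
    by (rule sum.nat_group [symmetric])
  also have "\<dots> = (\<Sum>i<a. \<Sum>j<b. f i j)"
  proof (rule sum.cong [OF refl])
    fix i
    have "sum (\<lambda>k. f (k div b) (k mod b)) {i * b..<i * b + b}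
        = (\<Sum>j\<in>{0..<b}. f ((j + i * b) div b) ((j + i * b) mod b))"
      using sum.shift_bounds_nat_ivl [of "\<lambda>k. f (k div b) (k mod b)" 0 "i * b" b]
      by (simp add: add.commute)
    also have "\<dots> = (\<Sum>j<b. f i j)"
      using False by (intro sum.cong) auto
    finally show "sum (\<lambda>k. f (k div b) (k mod b)) {i * b..<i * b + b} = (\<Sum>j<b. f i j)" .
  qed
  finally show ?thesis .
qed simp

lemma div_mod_less_mult:
  fixes i a b :: nat
  assumes "i < a * b"
  shows "i div b < a" "i mod b < b"
proof -
  show "i div b < a" using assms by (simp add: less_mult_imp_div_less)
  show "i mod b < b" using assms by (cases "b = 0") auto
qed

lemma kron_carrier [simp]:
  assumes "A \<in> carrier_mat m n" "B \<in> carrier_mat p q"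
  shows "kron A B \<in> carrier_mat (m * p) (n * q)"
  using assms by (auto simp: kron_def)

text \<open>The mixed-product rule: once the summation index is split into quotient and remainder,
  the double sum factors into the two matrix products.\<close>

lemma kron_mult:
  assumes A: "A \<in> carrier_mat m n" and B: "B \<in> carrier_mat p q"
    and C: "C \<in> carrier_mat n r" and D: "D \<in> carrier_mat q s"
  shows "kron A B * kron C D = kron (A * C) (B * D :: 'a::comm_semiring_0 mat)"
proof (rule eq_matI)
  fix i j assume "i < dim_row (kron (A * C) (B * D))" "j < dim_col (kron (A * C) (B * D))"
  then have ij: "i < m * p" "j < r * s" using assms by (auto simp: kron_def)
  note ltI = div_mod_less_mult [OF ij(1)] and ltJ = div_mod_less_mult [OF ij(2)]
  have "(kron A B * kron C D) $$ (i, j) =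
      (\<Sum>k<n * q. A $$ (i div p, k div q) * B $$ (i mod p, k mod q) *
        (C $$ (k div q, j div s) * D $$ (k mod q, j mod s)))"
    using assms ij by (auto simp: kron_def scalar_prod_def atLeast0LessThan intro!: sum.cong)
  also have "\<dots> = (\<Sum>k<n. \<Sum>l<q. A $$ (i div p, k) * B $$ (i mod p, l) *
        (C $$ (k, j div s) * D $$ (l, j mod s)))"
    by (rule sum_lessThan_mult)
  also have "\<dots> = (\<Sum>k<n. A $$ (i div p, k) * C $$ (k, j div s)) *
       (\<Sum>l<q. B $$ (i mod p, l) * D $$ (l, j mod s))"
    by (simp add: sum_product mult_ac)
  also have "\<dots> = kron (A * C) (B * D) $$ (i, j)"
    using assms ij ltI ltJ by (auto simp: kron_def scalar_prod_def atLeast0LessThan)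
  finally show "(kron A B * kron C D) $$ (i, j) = kron (A * C) (B * D) $$ (i, j)" .
qed (use assms in \<open>auto simp: kron_def\<close>)

lemma kron_smult_left: "kron (a \<cdot>\<^sub>m A) B = (a :: 'a::comm_semiring_0) \<cdot>\<^sub>m kron A B"
  and kron_smult_right: "kron A (a \<cdot>\<^sub>m B) = a \<cdot>\<^sub>m kron A B"
  by (rule eq_matI; simp add: kron_def div_mod_less_mult mult_ac)+

lemma kron_adjoint:
  "map_mat cnj (kron A B)\<^sup>T = kron (map_mat cnj A\<^sup>T) (map_mat cnj B\<^sup>T)"
  by (rule eq_matI) (auto simp: kron_def div_mod_less_mult)

lemma kron_mat_diag:
  "kron (mat_diag p f) (mat_diag q g) =
     mat_diag (p * q) (\<lambda>i. f (i div q) * g (i mod q) :: 'a::semiring_0)"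
proof (rule eq_matI)
  fix i j
  assume "i < dim_row (mat_diag (p * q) (\<lambda>i. f (i div q) * g (i mod q)))"
    "j < dim_col (mat_diag (p * q) (\<lambda>i. f (i div q) * g (i mod q)))"
  then have "i < p * q" "j < p * q" by (auto simp: mat_diag_def)
  moreover have "i div q = j div q \<and> i mod q = j mod q \<longleftrightarrow> i = j"
    by (metis div_mult_mod_eq)
  ultimately show "kron (mat_diag p f) (mat_diag q g) $$ (i, j) =
      mat_diag (p * q) (\<lambda>i. f (i div q) * g (i mod q)) $$ (i, j)"
    by (auto simp: kron_def mat_diag_def div_mod_less_mult)
qed (auto simp: kron_def mat_diag_def)

lemma kron_one_one: "kron (1\<^sub>m p) (1\<^sub>m q) = (1\<^sub>m (p * q) :: 'a::semiring_1 mat)"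
  using kron_mat_diag [of p "\<lambda>_. 1 :: 'a" q "\<lambda>_. 1"] by simp

section \<open>Algebra of diagonal matrices\<close>

lemma smult_mat_diag: "a \<cdot>\<^sub>m mat_diag n f = mat_diag n (\<lambda>i. a * f i :: 'a::semiring_0)"
  and add_mat_diag: "mat_diag n f + mat_diag n g = mat_diag n (\<lambda>i. f i + g i)"
  and zero_mat_diag: "0\<^sub>m n n = mat_diag n (\<lambda>i. 0 :: 'a)"
  by (auto simp: mat_diag_def)

lemma uminus_mat_diag: "- mat_diag n f = mat_diag n (\<lambda>i. - f i :: 'a::group_add)"
  by (auto simp: mat_diag_def)

lemma mat_diag_pow2:
  fixes f :: "nat \<Rightarrow> 'a::semiring_1"
  shows "mat_diag n f ^\<^sub>m 2 = mat_diag n (\<lambda>i. f i ^ 2)"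
proof -
  have "mat_diag n f ^\<^sub>m 2 = (1\<^sub>m n * mat_diag n f) * mat_diag n f"
    by (simp add: numeral_2_eq_2 mat_diag_def)
  then show ?thesis
    by (simp add: left_mult_one_mat [OF mat_diag_dim] power2_eq_square)
qed

lemma mat_diag_mult_vec:
  fixes f :: "nat \<Rightarrow> 'a::semiring_0"
  assumes "dim_vec v = n"
  shows "mat_diag n f *\<^sub>v v = vec n (\<lambda>i. f i * v $ i)"
proof (rule eq_vecI)
  fix i assume "i < dim_vec (vec n (\<lambda>i. f i * v $ i))"
  then have "i < n" by simp
  then have "(mat_diag n f *\<^sub>v v) $ i = (\<Sum>j\<in>{0..<n}. if i = j then f i * v $ i else 0)"
    using assms by (auto simp: mat_diag_def scalar_prod_def if_distrib [of "\<lambda>x. x * _"] cong: if_cong intro!: sum.cong)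
  then show "(mat_diag n f *\<^sub>v v) $ i = vec n (\<lambda>i. f i * v $ i) $ i"
    using \<open>i < n\<close> by simp
qed (simp add: mat_diag_def)

text \<open>Moving \<open>A\<close> across the scalar product turns it into its adjoint, and
  \<open>iso\<close> collapses the product. The factor \<open>c\<close> is there because the inverse
  Fourier matrix is unitary only up to scaling.\<close>

lemma scalar_prod_isometry:
  fixes A :: "complex mat"
  assumes A: "A \<in> carrier_mat n n" and iso: "map_mat cnj A\<^sup>T * A = complex_of_real c \<cdot>\<^sub>m 1\<^sub>m n"
    and x: "x \<in> carrier_vec n" and y: "y \<in> carrier_vec n"
  shows "(A *\<^sub>v x) \<bullet>c (A *\<^sub>v y) = complex_of_real c * (x \<bullet>c y)"
proof -
  let ?B = "map_mat cnj A\<^sup>T"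
  have B: "?B \<in> carrier_mat n n" using A by simp
  have conj: "conjugate (?B *\<^sub>v (A *\<^sub>v y)) = A\<^sup>T *\<^sub>v conjugate (A *\<^sub>v y)"
    using A y by (intro eq_vecI) (auto simp: scalar_prod_def)
  have "?B *\<^sub>v (A *\<^sub>v y) = (complex_of_real c \<cdot>\<^sub>m 1\<^sub>m n) *\<^sub>v y"
    unfolding iso [symmetric] by (rule assoc_mult_mat_vec [symmetric, OF B A y])
  also have "\<dots> = complex_of_real c \<cdot>\<^sub>v y"
    using y mat_diag_mult_vec [of y n "\<lambda>_. complex_of_real c"]
    by (auto simp: smult_mat_diag simp flip: mat_diag_one)
  finally have "A\<^sup>T *\<^sub>v conjugate (A *\<^sub>v y) = complex_of_real c \<cdot>\<^sub>v conjugate y"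
    using conj by (simp add: conjugate_smult_vec)
  moreover have "(A *\<^sub>v x) \<bullet>c (A *\<^sub>v y) = (A\<^sup>T *\<^sub>v conjugate (A *\<^sub>v y)) \<bullet> x"
  proof -
    have "(A\<^sup>T *\<^sub>v conjugate (A *\<^sub>v y)) \<bullet> x = conjugate (A *\<^sub>v y) \<bullet> (A *\<^sub>v x)"
      using transpose_vec_mult_scalar [OF A x, of "conjugate (A *\<^sub>v y)"] A y by simp
    then show ?thesis
      using A x y by (simp add: comm_scalar_prod [of _ n])
  qed
  ultimately show ?thesis
    using x y by (simp add: comm_scalar_prod [of _ n])
qed

section \<open>Block matrices acting on stacked vectors\<close>

lemma comp3_block3:
  assumes v: "dim_vec v = 3 * n"
  shows "comp3 n (block3 n bs *\<^sub>v v) w = vec n (\<lambda>i. \<Sum>q<3. \<Sum>j<n.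
     (bs ! axis_index w ! q) $$ (i, j) * v $ (q * n + j))"
proof (rule eq_vecI)
  fix i assume "i < dim_vec (vec n (\<lambda>i. \<Sum>q<3. \<Sum>j<n.
     (bs ! axis_index w ! q) $$ (i, j) * v $ (q * n + j)))"
  then have i: "i < n" by simp
  have ai: "axis_index w * n + i < 3 * n" using i by (cases w) auto
  have "comp3 n (block3 n bs *\<^sub>v v) w $ i = (\<Sum>k<3 * n.
      (bs ! axis_index w ! (k div n)) $$ (i, k mod n) * v $ (k div n * n + k mod n))"
    using i ai v by (auto simp: comp3_def block3_def scalar_prod_def atLeast0LessThan intro!: sum.cong)
  also have "\<dots> = (\<Sum>q<3. \<Sum>j<n. (bs ! axis_index w ! q) $$ (i, j) * v $ (q * n + j))"
    by (rule sum_lessThan_mult)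
  finally show "comp3 n (block3 n bs *\<^sub>v v) w $ i = vec n (\<lambda>i. \<Sum>q<3. \<Sum>j<n.
     (bs ! axis_index w ! q) $$ (i, j) * v $ (q * n + j)) $ i" using i by simp
qed (simp add: comp3_def)

lemma comp3_block3_mult:
  assumes "dim_vec v = 3 * n"
    and "\<And>p q. p < 3 \<Longrightarrow> q < 3 \<Longrightarrow> bs ! p ! q \<in> carrier_mat n n"
  shows "comp3 n (block3 n bs *\<^sub>v v) w =
    (bs ! axis_index w ! 0) *\<^sub>v comp3 n v xdir + (bs ! axis_index w ! 1) *\<^sub>v comp3 n v ydir
    + (bs ! axis_index w ! 2) *\<^sub>v comp3 n v zdir"
proof -
  have w: "axis_index w < 3" by (cases w) auto
  have *: "bs ! axis_index w ! 0 \<in> carrier_mat n n" "bs ! axis_index w ! Suc 0 \<in> carrier_mat n n"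
    "bs ! axis_index w ! 2 \<in> carrier_mat n n"
    using assms(2) [OF w] by auto
  show ?thesis
    unfolding comp3_block3 [OF assms(1)]
    by (rule eq_vecI) (use * in \<open>auto simp: comp3_def scalar_prod_def atLeast0LessThan
      eval_nat_numeral intro!: sum.cong\<close>)
qed

lemma dim_stack3:
  assumes "\<And>w. dim_vec (u w) = n"
  shows "dim_vec (stack3 u) = 3 * n"
  using assms by (simp add: stack3_def)

lemma stack3_index:
  assumes "\<And>w. dim_vec (u w) = n" "i < n"
  shows "stack3 u $ (axis_index w * n + i) = u w $ i"
  using assms by (cases w) (auto simp: stack3_def)

lemma comp3_stack3:
  assumes "\<And>w. dim_vec (u w) = n"
  shows "comp3 n (stack3 u) w = u w"
  by (rule eq_vecI) (simp_all add: comp3_def stack3_index assms)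

lemma stack3_comp3:
  assumes "dim_vec v = 3 * n"
  shows "stack3 (comp3 n v) = v"
  by (rule eq_vecI) (auto simp: comp3_def stack3_def assms not_less)

lemma stack3_eqI:
  assumes "dim_vec v = 3 * n" and "\<And>w. comp3 n v w = u w"
  shows "v = stack3 u"
  using stack3_comp3 [OF assms(1)] assms(2) by (metis ext)

lemma stack3_scalar_prod:
  assumes "\<And>w. dim_vec (u w) = n" "\<And>w. dim_vec (v w) = n"
  shows "stack3 u \<bullet>c stack3 v = u xdir \<bullet>c v xdir + u ydir \<bullet>c v ydir + u zdir \<bullet>c v zdir"
proof -
  have conj: "conjugate (stack3 v) = stack3 (\<lambda>w. conjugate (v w))"
    by (rule eq_vecI) (auto simp: stack3_def)
  have c: "u w \<in> carrier_vec n" "conjugate (v w) \<in> carrier_vec n" for w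
    using assms by (auto intro!: carrier_vecI)
  show ?thesis
    unfolding conj unfolding stack3_def
    by (simp add: scalar_prod_append [of _ n _ "n + n"] scalar_prod_append [of _ n _ n] c add.assoc)
qed


section \<open>Diagonalization of the spectral differentiation matrix\<close>

definition root_one :: "nat \<Rightarrow> complex" where
  "root_one m = exp (2 * of_real pi * \<i> / of_nat m)"

lemma root_one_pow: "root_one m ^ k = cis (2 * pi * real k / real m)"
  unfolding root_one_def by (simp add: cis_conv_exp mult_ac flip: exp_of_nat_mult)

lemma root_one_nonzero [simp]: "root_one m \<noteq> 0"
  by (simp add: root_one_def)

lemma root_one_pow_self: "m > 0 \<Longrightarrow> root_one m ^ m = 1"
  by (simp add: root_one_pow cis_2pi)

lemma root_one_pow_half:
  assumes "even m" "m > 0"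
  shows "root_one m ^ (m div 2) = -1"
proof -
  have "2 * pi * real (m div 2) / real m = pi"
    using assms by (auto elim!: evenE)
  then show ?thesis by (simp add: root_one_pow)
qed

lemma inverse_root_one_pow: "inverse (root_one m ^ k) = cnj (root_one m ^ k)"
  by (simp add: root_one_pow cis_cnj)

lemma root_one_ratio: "root_one m ^ j / root_one m ^ l = cis (2 * pi * (real j - real l) / real m)"
  by (simp add: root_one_pow cis_divide diff_divide_distrib right_diff_distrib)

text \<open>The first \<open>m\<close> powers of the primitive root enumerate the
  \<open>m\<close>-th roots of unity injectively.\<close>

lemma root_one_ratio_neq_1:
  assumes "j < m" "l < m" "j \<noteq> l"
  shows "root_one m ^ j / root_one m ^ l \<noteq> 1"
proof
  assume "root_one m ^ j / root_one m ^ l = 1"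
  then have "root_one m ^ j = root_one m ^ l" by simp
  then show False
    using assms inj_onD [OF bij_betw_imp_inj_on [OF bij_betw_roots_unity [of m]], of j l]
    by (simp add: root_one_pow cis_conv_exp mult_ac)
qed

lemma sum_powers_root_of_unity:
  fixes z :: complex
  assumes "z ^ m = 1" "z \<noteq> 1"
  shows "(\<Sum>k<m. z ^ k) = 0"
  using assms by (simp add: sum_gp_strict)

lemma root_one_ratio_pow_self:
  assumes "m > 0"
  shows "(root_one m ^ j / root_one m ^ l) ^ m = 1"
proof -
  have "(root_one m ^ j / root_one m ^ l) ^ m = (root_one m ^ m) ^ j / (root_one m ^ m) ^ l"
    by (simp add: power_divide mult.commute flip: power_mult)
  then show ?thesis using assms by (simp add: root_one_pow_self)
qed

lemma dft_carrier [simp]: "dft m \<in> carrier_mat m m"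
  and idft_carrier [simp]: "idft m \<in> carrier_mat m m"
  by (simp_all add: dft_def idft_def)

text \<open>Each entry is a geometric sum over a ratio of roots of unity. The ratio is 1 on the
  diagonal; elsewhere it is a nontrivial \<open>m\<close>-th root of unity and the sum
  vanishes.\<close>

lemma dft_idft:
  assumes "m > 0"
  shows "dft m * idft m = 1\<^sub>m m"
proof (rule eq_matI)
  fix l j assume "l < dim_row (1\<^sub>m m :: complex mat)" "j < dim_col (1\<^sub>m m :: complex mat)"
  then have lj: "l < m" "j < m" by auto
  let ?z = "root_one m ^ j / root_one m ^ l"
  have "(dft m * idft m) $$ (l, j) = (\<Sum>k<m. inverse (root_one m ^ (l * k)) * (1 / of_nat m * root_one m ^ (k * j)))"
    using lj by (simp add: dft_def idft_def scalar_prod_def root_one_def atLeast0LessThan)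
  also have "\<dots> = 1 / of_nat m * (\<Sum>k<m. ?z ^ k)"
    by (auto simp: sum_distrib_left power_divide field_simps simp flip: power_mult intro!: sum.cong)
  also have "\<dots> = (if l = j then 1 else 0)"
    using assms lj sum_powers_root_of_unity [OF root_one_ratio_pow_self root_one_ratio_neq_1, of m j l]
    by auto
  finally show "(dft m * idft m) $$ (l, j) = 1\<^sub>m m $$ (l, j)" using lj by simp
qed (auto simp: dft_def idft_def)

text \<open>Conjugation inverts a root of unity, and the exponent \<open>j * k\<close> is
  symmetric.\<close>

lemma idft_adjoint: "map_mat cnj (idft m)\<^sup>T = (1 / of_nat m) \<cdot>\<^sub>m dft m"
  unfolding dft_def idft_def root_one_def [symmetric]
  by (rule eq_matI) (auto simp: inverse_root_one_pow mult.commute)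

section \<open>Power sums weighted by the frequencies\<close>

definition fourier_freq :: "nat \<Rightarrow> nat \<Rightarrow> complex" where
  "fourier_freq m k = (if k < m div 2 then of_nat k else if k = m div 2 then 0 else of_nat k - of_nat m)"

text \<open>The arithmetic-geometric sum, kept free of division so that it is a ring identity
  provable by induction.\<close>

lemma sum_index_times_power:
  fixes z :: "'a::comm_ring_1"
  shows "(z - 1) * (\<Sum>k<n. of_nat k * z ^ k) = of_nat n * z ^ n - z * (\<Sum>k<n. z ^ k)"
  by (induction n) (simp_all add: algebra_simps)

text \<open>The last summand corrects the entry \<open>k = m\<close>, which is 0 instead of \<open>- m\<close>.\<close>
lemma sum_fourier_freq_split:
  assumes "m > 0"
  shows "(\<Sum>k<2 * m. fourier_freq (2 * m) k * z ^ k) =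
    (\<Sum>k<m. of_nat k * z ^ k) + z ^ m * ((\<Sum>k<m. of_nat k * z ^ k) - of_nat m * (\<Sum>k<m. z ^ k))
    + of_nat m * z ^ m"
proof -
  have "(\<Sum>k<2 * m. fourier_freq (2 * m) k * z ^ k) =
      (\<Sum>k<m. fourier_freq (2 * m) k * z ^ k) + (\<Sum>k<m. fourier_freq (2 * m) (k + m) * z ^ (k + m))"
    using sum.atLeastLessThan_concat [of 0 m "2 * m" "\<lambda>k. fourier_freq (2 * m) k * z ^ k"]
      sum.shift_bounds_nat_ivl [of "\<lambda>k. fourier_freq (2 * m) k * z ^ k" 0 m m]
    by (simp add: atLeast0LessThan mult_2)
  also have "(\<Sum>k<m. fourier_freq (2 * m) k * z ^ k) = (\<Sum>k<m. of_nat k * z ^ k)"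
    by (intro sum.cong) (auto simp: fourier_freq_def)
  also have "(\<Sum>k<m. fourier_freq (2 * m) (k + m) * z ^ (k + m)) =
      (\<Sum>k<m. z ^ m * (of_nat k * z ^ k - of_nat m * z ^ k) + (if k = 0 then of_nat m * z ^ m else 0))"
    by (intro sum.cong) (auto simp: fourier_freq_def power_add algebra_simps)
  also have "\<dots> = z ^ m * ((\<Sum>k<m. of_nat k * z ^ k) - of_nat m * (\<Sum>k<m. z ^ k)) + of_nat m * z ^ m"
    using assms by (simp add: sum.distrib sum_subtractf sum_distrib_left right_diff_distrib)
  finally show ?thesis by (simp add: add.assoc)
qed

text \<open>With \<open>q = z ^ m\<close> the hypothesis reads \<open>q * q = 1\<close>, so the
  half-length geometric sum \<open>G\<close> satisfies \<open>G * q = - G\<close>. After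
  multiplication of the split sum by \<open>z - 1\<close> all terms with \<open>G\<close>
  cancel.\<close>

lemma sum_fourier_freq:
  assumes "m > 0" "z ^ (2 * m) = 1" "z \<noteq> 1"
  shows "(\<Sum>k<2 * m. fourier_freq (2 * m) k * z ^ k) = of_nat m * z ^ m * (z + 1) / (z - 1)"
proof -
  define S where "S = (\<Sum>k<m. of_nat k * z ^ k)"
  define G where "G = (\<Sum>k<m. z ^ k)"
  define q where "q = z ^ m"
  have q2: "q * q = 1"
    using assms(2) by (simp add: q_def mult_2 power_add)
  have S: "(z - 1) * S = of_nat m * q - z * G"
    unfolding S_def G_def q_def by (rule sum_index_times_power)
  have zG: "(z - 1) * G = q - 1"
    using assms(3) by (simp add: G_def q_def sum_gp_strict field_simps)
  then have "(z - 1) * (G * (q + 1)) = (q - 1) * (q + 1)"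
    by (simp flip: mult.assoc)
  also have "\<dots> = 0"
    using q2 by (simp add: algebra_simps)
  finally have "G * (q + 1) = 0" using assms(3) by simp
  then have G: "G * q = - G"
    by (simp add: distrib_left eq_neg_iff_add_eq_0)
  have "(z - 1) * (S + q * (S - of_nat m * G) + of_nat m * q)
      = (1 + q) * ((z - 1) * S) + of_nat m * (z - 1) * (q - q * G)"
    by (simp add: algebra_simps)
  also have "\<dots> = of_nat m * q * (z + 1)"
  proof -
    have "(1 + q) * (of_nat m * q - z * G) = of_nat m * q + of_nat m * (q * q) - z * (G + G * q)"
      by (simp add: algebra_simps)
    then have 1: "(1 + q) * (of_nat m * q - z * G) = of_nat m * q + of_nat m"
      unfolding q2 G by simp
    have "of_nat m * (z - 1) * (q - q * G) = of_nat m * ((z - 1) * q) - of_nat m * ((z - 1) * (G * q))"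
      by (simp add: algebra_simps)
    then have 2: "of_nat m * (z - 1) * (q - q * G) = of_nat m * ((z - 1) * q) + of_nat m * (q - 1)"
      unfolding G mult_minus_right zG by simp
    show ?thesis unfolding S 1 2 by (simp add: algebra_simps)
  qed
  finally show ?thesis
    unfolding sum_fourier_freq_split [OF assms(1)]
    using assms(3) by (simp add: S_def G_def q_def field_simps)
qed

text \<open>The case \<open>z = 1\<close>, where the quotient formula breaks down; it accounts for
  the zero diagonal of \<open>diff_mat\<close>.\<close>

lemma sum_fourier_freq_0:
  assumes "m > 0"
  shows "(\<Sum>k<2 * m. fourier_freq (2 * m) k) = 0"
proof -
  have *: "2 * (\<Sum>k<n. of_nat k) = (of_nat n * (of_nat n - 1) :: complex)" for n
    by (induction n) (simp_all add: algebra_simps)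
  show ?thesis
    using sum_fourier_freq_split [OF assms, of 1] * [of m] by (simp add: algebra_simps)
qed

text \<open>Taking the factor \<open>cis x\<close> out of numerator and denominator leaves
  \<open>2 * cos x\<close> and \<open>2 * \<i> * sin x\<close>. This is how the cotangent of
  \<open>diff_mat\<close> arises from a power sum.\<close>

lemma cis_half_angle:
  assumes "cis (2 * x) \<noteq> 1"
  shows "\<i> * (cis (2 * x) + 1) / (cis (2 * x) - 1) = complex_of_real (cot x)"
proof -
  have sin: "sin x \<noteq> 0"
  proof
    assume "sin x = 0"
    then have "cis (2 * x) = 1"
      by (auto simp: complex_eq_iff cos_double sin_double cos_squared_eq)
    then show False using assms by simp
  qed
  have p: "cis (2 * x) + 1 = 2 * of_real (cos x) * cis x"
    by (simp add: complex_eq_iff cos_double_cos sin_double power2_eq_square)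
  have m: "cis (2 * x) - 1 = 2 * \<i> * of_real (sin x) * cis x"
    by (simp add: complex_eq_iff cos_double_sin sin_double power2_eq_square)
  show ?thesis unfolding p m using sin by (simp add: cot_def)
qed

text \<open>The right side is the entry of \<open>idft\<close> times \<open>\<i>\<close> times the
  frequency matrix times \<open>dft\<close>. Off the diagonal, \<open>sum_fourier_freq\<close> gives
  the sign through \<open>z ^ m\<close> and the cotangent through
  \<open>(z + 1) / (z - 1)\<close>.\<close>

lemma diff_mat_fourier:
  assumes "N w > 0" "even (N w)" "L w < R w" "j < N w" "l < N w"
  shows "diff_mat N L R w $$ (j, l) = (\<Sum>k<N w. 1 / of_nat (N w) *
     (\<i> * (complex_of_real (nu L R w) * fourier_freq (N w) k)) * (root_one (N w) ^ j / root_one (N w) ^ l) ^ k)"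
proof -
  obtain m where m: "N w = 2 * m" "m > 0" using assms by auto
  define \<rho> where "\<rho> = root_one (2 * m)"
  define z where "z = \<rho> ^ j / \<rho> ^ l"
  define S where "S = (\<Sum>k<2 * m. fourier_freq (2 * m) k * z ^ k)"
  have rhs: "(\<Sum>k<N w. 1 / of_nat (N w) * (\<i> * (complex_of_real (nu L R w) * fourier_freq (N w) k))
      * (root_one (N w) ^ j / root_one (N w) ^ l) ^ k)
    = 1 / of_nat (2 * m) * \<i> * complex_of_real (nu L R w) * S"
    unfolding m(1) \<rho>_def [symmetric] z_def [symmetric] S_def
    by (simp add: sum_distrib_left mult.assoc)
  show ?thesis
  proof (cases "j = l")
    case True
    then have "z = 1" by (simp add: z_def \<rho>_def)
    then have "S = 0" using sum_fourier_freq_0 [OF m(2)] by (simp add: S_def)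
    then show ?thesis unfolding rhs using True assms by (simp add: diff_mat_def)
  next
    case False
    have z1: "z \<noteq> 1" and zp: "z ^ (2 * m) = 1"
      using root_one_ratio_neq_1 [OF assms(4,5) False] root_one_ratio_pow_self [OF assms(1)]
      by (auto simp: z_def \<rho>_def m(1))
    \<comment> \<open>Half the argument of \<open>z\<close>, which is also the angle inside the
      cotangent of \<open>diff_mat\<close>.\<close>
    define x where "x = pi * (real j - real l) / real (2 * m)"
    have zx: "z = cis (2 * x)"
      unfolding z_def \<rho>_def root_one_ratio x_def by (simp add: mult.assoc)
    have "z ^ m = (\<rho> ^ m) ^ j / (\<rho> ^ m) ^ l"
      by (simp add: z_def power_divide mult.commute flip: power_mult)
    \<comment> \<open>Here evenness of \<open>N w\<close> matters: \<open>m\<close> is half the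
      order of the primitive root \<open>\<rho>\<close>.\<close>
    also have "\<rho> ^ m = -1"
      using root_one_pow_half [of "2 * m"] m(2) by (simp add: \<rho>_def)
    also have "(-1) ^ j / (-1) ^ l = ((-1) ^ (j + l) :: complex)"
      by (cases "even l") (simp_all add: power_add)
    finally have zm: "z ^ m = (-1) ^ (j + l)" .
    have "S = of_nat m * z ^ m * (z + 1) / (z - 1)"
      unfolding S_def by (rule sum_fourier_freq [OF m(2) zp z1])
    then have "\<i> * S = of_nat m * z ^ m * (\<i> * (z + 1) / (z - 1))"
      by (simp only: times_divide_eq_right mult.assoc mult.left_commute)
    also have "\<dots> = of_nat m * (-1) ^ (j + l) * complex_of_real (cot x)"
      using cis_half_angle [of x, folded zx, OF z1] zm by (simp only:)
    finally have S: "\<i> * S = of_nat m * (-1) ^ (j + l) * complex_of_real (cot x)" .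
    have "nu L R w * (grid_pt N L R w j - grid_pt N L R w l) / 2 = x"
    proof -
      have "grid_pt N L R w j - grid_pt N L R w l
          = (R w - L w) * ((real j - real l) / real (2 * m))"
        unfolding grid_pt_def m(1) using m(2) by (simp add: field_simps)
      then show ?thesis
        using assms(3) by (simp add: nu_def x_def)
    qed
    then have "diff_mat N L R w $$ (j, l)
        = complex_of_real (1 / 2 * nu L R w * (-1) ^ (j + l) * cot x)"
      using False assms by (simp add: diff_mat_def)
    also have "\<dots> = 1 / of_nat (2 * m) * complex_of_real (nu L R w) * (\<i> * S)"
    proof -
      have *: "1 / of_nat (2 * m) * c * (of_nat m * s * d) = 1 / 2 * c * s * d" for c s d :: complex
        using m(2) by simp
      then show ?thesis unfolding S * by simp
    qed
    finally show ?thesis unfolding rhs by (simp only: mult_ac)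
  qed
qed

lemma freq_mat_eq:
  "freq_mat N L R w = mat_diag (N w) (\<lambda>k. complex_of_real (nu L R w) * fourier_freq (N w) k)"
  by (simp add: freq_mat_def smult_mat_diag fourier_freq_def cong: if_cong)

text \<open>The columns of the inverse Fourier matrix are eigenvectors of \<open>diff_mat\<close>.
  The factorization read off from \<open>diff_mat_fourier\<close> is multiplied by
  \<open>idft\<close> from the right, where \<open>dft_idft\<close> cancels the last two
  factors.\<close>

lemma diff_mat_idft:
  assumes "N w > 0" "even (N w)" "L w < R w"
  shows "diff_mat N L R w * idft (N w) = idft (N w) * (\<i> \<cdot>\<^sub>m freq_mat N L R w)"
proof -
  let ?F = "idft (N w)" and ?\<Lambda> = "\<i> \<cdot>\<^sub>m freq_mat N L R w"
  have \<Lambda>: "?\<Lambda> = mat_diag (N w) (\<lambda>k. \<i> * (complex_of_real (nu L R w) * fourier_freq (N w) k))"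
    by (simp add: freq_mat_eq smult_mat_diag)
  have c: "?\<Lambda> \<in> carrier_mat (N w) (N w)" by (simp add: freq_mat_eq)
  have "diff_mat N L R w = ?F * ?\<Lambda> * dft (N w)"
  proof (rule eq_matI)
    fix j l assume "j < dim_row (?F * ?\<Lambda> * dft (N w))" "l < dim_col (?F * ?\<Lambda> * dft (N w))"
    then have jl: "j < N w" "l < N w" by (auto simp: dft_def idft_def)
    have "(?F * ?\<Lambda> * dft (N w)) $$ (j, l) = (\<Sum>k<N w. 1 / of_nat (N w) * root_one (N w) ^ (j * k) *
       (\<i> * (complex_of_real (nu L R w) * fourier_freq (N w) k)) * inverse (root_one (N w) ^ (k * l)))"
      using jl unfolding \<Lambda> mat_diag_mult_right [OF idft_carrier]
      by (simp add: dft_def idft_def scalar_prod_def atLeast0LessThan flip: root_one_def)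
    also have "\<dots> = diff_mat N L R w $$ (j, l)"
      unfolding diff_mat_fourier [of N w L R, OF assms jl]
      by (intro sum.cong) (auto simp: power_divide field_simps simp flip: power_mult)
    finally show "diff_mat N L R w $$ (j, l) = (?F * ?\<Lambda> * dft (N w)) $$ (j, l)" by simp
  qed (auto simp: diff_mat_def dft_def idft_def)
  then have "diff_mat N L R w * ?F = ?F * ?\<Lambda> * dft (N w) * ?F"
    by (rule arg_cong)
  also have "\<dots> = ?F * ?\<Lambda> * (dft (N w) * ?F)"
    by (rule assoc_mult_mat [OF mult_carrier_mat [OF idft_carrier c] dft_carrier idft_carrier])
  also have "\<dots> = ?F * ?\<Lambda>"
    unfolding dft_idft [OF assms(1)]
    by (rule right_mult_one_mat [OF mult_carrier_mat [OF idft_carrier c]])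
  finally show ?thesis .
qed


section \<open>Evolution of a single Fourier mode\<close>

definition wavenumber :: "(axis \<Rightarrow> real) \<Rightarrow> real" where
  "wavenumber \<omega> = sqrt (\<omega> xdir ^ 2 + \<omega> ydir ^ 2 + \<omega> zdir ^ 2)"

text \<open>The Fourier symbol of the curl, a cross product with \<open>\<i> * \<omega>\<close>.
  Values at one mode are functions on \<open>axis\<close> instead of vectors, which avoids dimension
  conditions.\<close>

fun curl_sym :: "(axis \<Rightarrow> real) \<Rightarrow> (axis \<Rightarrow> complex) \<Rightarrow> axis \<Rightarrow> complex" where
  "curl_sym \<omega> x xdir = \<i> * (of_real (\<omega> ydir) * x zdir - of_real (\<omega> zdir) * x ydir)"
| "curl_sym \<omega> x ydir = \<i> * (of_real (\<omega> zdir) * x xdir - of_real (\<omega> xdir) * x zdir)"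
| "curl_sym \<omega> x zdir = \<i> * (of_real (\<omega> xdir) * x ydir - of_real (\<omega> ydir) * x xdir)"

definition herm :: "(axis \<Rightarrow> complex) \<Rightarrow> (axis \<Rightarrow> complex) \<Rightarrow> complex" where
  "herm x y = x xdir * cnj (y xdir) + x ydir * cnj (y ydir) + x zdir * cnj (y zdir)"

text \<open>
  On the Fourier mode with wave vector \<open>\<omega>\<close>, the blocks of \<open>c\<close> and \<open>s\<close> are \<open>cos (\<tau> K)\<close> and
  \<open>sin (\<tau> K)\<close> with \<open>K = curl_sym \<omega>\<close>, written as polynomials in \<open>K\<close> by means of \<open>K\<^sup>3 = \<kappa>\<^sup>2 K\<close>.
  The magnetic mode is \<open>evolve r H E\<close> with \<open>r = \<surd>\<epsilon> / \<surd>\<mu>\<close>, the electric one is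
  \<open>evolve (- 1 / r) E H\<close>.  The quotients take the junk value 0 at \<open>\<kappa> = 0\<close>, where \<open>K = 0\<close>.
\<close>
definition evolve :: "real \<Rightarrow> (axis \<Rightarrow> real) \<Rightarrow> real \<Rightarrow> (axis \<Rightarrow> complex) \<Rightarrow> (axis \<Rightarrow> complex) \<Rightarrow>
    axis \<Rightarrow> complex" where
  "evolve r \<omega> \<tau> x y = (let \<kappa> = wavenumber \<omega> in (\<lambda>w.
     x w + of_real ((cos (\<tau> * \<kappa>) - 1) / \<kappa>\<^sup>2) * curl_sym \<omega> (curl_sym \<omega> x) w
     - of_real (r * (sin (\<tau> * \<kappa>) / \<kappa>)) * curl_sym \<omega> y w))"

lemma wavenumber_square: "wavenumber \<omega> ^ 2 = \<omega> xdir ^ 2 + \<omega> ydir ^ 2 + \<omega> zdir ^ 2"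
  by (simp add: wavenumber_def)

lemma wavenumber_eq_0: "wavenumber \<omega> = 0 \<longleftrightarrow> (\<forall>w. \<omega> w = 0)"
proof
  assume "wavenumber \<omega> = 0"
  then have "\<omega> xdir ^ 2 + \<omega> ydir ^ 2 + \<omega> zdir ^ 2 = 0"
    by (simp flip: wavenumber_square)
  then have "\<omega> xdir = 0 \<and> \<omega> ydir = 0 \<and> \<omega> zdir = 0"
    by (simp add: add_nonneg_eq_0_iff)
  then show "\<forall>w. \<omega> w = 0" by (metis axis.exhaust)
qed (simp add: wavenumber_def)

text \<open>Ensures that a quotient by a vanishing wavenumber always meets a zero factor.\<close>

lemma curl_sym_wavenumber_0:
  assumes "wavenumber \<omega> = 0"
  shows "curl_sym \<omega> x w = 0"
  using assms by (cases w) (auto simp: wavenumber_eq_0)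

text \<open>By the triple product rule, the square of the symbol sends \<open>x\<close> to
  \<open>\<kappa>\<^sup>2\<close> times \<open>x\<close> minus a multiple of
  \<open>\<omega>\<close>, and the symbol annihilates \<open>\<omega>\<close>.\<close>

lemma curl_sym_cube:
  "curl_sym \<omega> (curl_sym \<omega> (curl_sym \<omega> x)) w = of_real (wavenumber \<omega> ^ 2) * curl_sym \<omega> x w"
  unfolding wavenumber_square by (cases w) (simp_all add: algebra_simps power2_eq_square)

text \<open>The symbol is \<open>\<i>\<close> times a real antisymmetric matrix, hence
  Hermitian.\<close>

lemma herm_curl_sym: "herm (curl_sym \<omega> x) y = herm x (curl_sym \<omega> y)"
  by (simp add: herm_def algebra_simps)

lemma herm_scale:
  "herm (\<lambda>w. of_real a * x w) (curl_sym \<omega> (\<lambda>w. of_real a * x w)) = of_real (a\<^sup>2) * herm x (curl_sym \<omega> x)"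
  by (simp add: herm_def algebra_simps power2_eq_square)

text \<open>\<open>evolve\<close> is a combination of powers of \<open>curl_sym \<omega>\<close>
  applied to the data, so it commutes with \<open>curl_sym \<omega>\<close>.\<close>

lemma curl_sym_evolve:
  "curl_sym \<omega> (evolve r \<omega> \<tau> x y) = evolve r \<omega> \<tau> (curl_sym \<omega> x) (curl_sym \<omega> y)"
proof
  fix w
  have "curl_sym \<omega> (\<lambda>w. x w + \<alpha> * u w - \<beta> * v w) w
      = curl_sym \<omega> x w + \<alpha> * curl_sym \<omega> u w - \<beta> * curl_sym \<omega> v w" for \<alpha> \<beta> u v
    by (cases w) (simp_all add: algebra_simps)
  then show "curl_sym \<omega> (evolve r \<omega> \<tau> x y) w = evolve r \<omega> \<tau> (curl_sym \<omega> x) (curl_sym \<omega> y) w"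
    unfolding evolve_def Let_def .
qed

text \<open>One more application of the symbol makes \<open>curl_sym_cube\<close> applicable; it
  absorbs the quotient with \<open>\<kappa>\<^sup>2\<close>, and the first datum keeps only a
  cosine.\<close>

lemma curl_sym_evolve_reduced:
  "curl_sym \<omega> (evolve r \<omega> \<tau> x y) w = of_real (cos (\<tau> * wavenumber \<omega>)) * curl_sym \<omega> x w
     - of_real (r * (sin (\<tau> * wavenumber \<omega>) / wavenumber \<omega>)) * curl_sym \<omega> (curl_sym \<omega> y) w"
proof (cases "wavenumber \<omega> = 0")
  case True
  then show ?thesis by (simp add: curl_sym_wavenumber_0)
next
  case False
  then have "1 + (cos (\<tau> * wavenumber \<omega>) - 1) / (wavenumber \<omega>)\<^sup>2 * (wavenumber \<omega>)\<^sup>2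
      = cos (\<tau> * wavenumber \<omega>)" by simp
  then have "complex_of_real (cos (\<tau> * wavenumber \<omega>)) =
      1 + of_real ((cos (\<tau> * wavenumber \<omega>) - 1) / (wavenumber \<omega>)\<^sup>2) * of_real ((wavenumber \<omega>)\<^sup>2)"
    by (metis of_real_1 of_real_add of_real_mult)
  then show ?thesis
    unfolding curl_sym_evolve unfolding evolve_def Let_def curl_sym_cube
    by (simp only: distrib_right mult_1 mult.assoc)
qed

lemma herm_expand:
  fixes a b c d p q :: real
  shows "herm (\<lambda>w. u w + of_real p * v w - of_real q * z w) (\<lambda>w. of_real c * x w - of_real d * y w) =
    of_real c * herm u x - of_real d * herm u y + of_real (p * c) * herm v x - of_real (p * d) * herm v y
    - of_real (q * c) * herm z x + of_real (q * d) * herm z y"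
  by (simp add: herm_def algebra_simps)

lemma herm_mult_right: "herm x (\<lambda>w. of_real a * y w) = of_real a * herm x y"
  by (simp add: herm_def algebra_simps)

text \<open>The right argument is taken in reduced form, the left one as defined. Hermitian symmetry
  collects the symbols in the second argument, where the cube relation lowers their power.\<close>

lemma helicity_evolve:
  fixes r \<tau> \<omega> x y
  defines "\<kappa> \<equiv> wavenumber \<omega>"
  defines "g \<equiv> cos (\<tau> * \<kappa>)" and "b \<equiv> sin (\<tau> * \<kappa>) / \<kappa>"
  shows "herm (evolve r \<omega> \<tau> x y) (curl_sym \<omega> (evolve r \<omega> \<tau> x y)) =
     of_real (g\<^sup>2) * herm x (curl_sym \<omega> x) + of_real (r\<^sup>2 * (sin (\<tau> * \<kappa>))\<^sup>2) * herm y (curl_sym \<omega> y)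
     - of_real (r * g * b) * (herm x (curl_sym \<omega> (curl_sym \<omega> y)) + herm y (curl_sym \<omega> (curl_sym \<omega> x)))"
proof (cases "\<kappa> = 0")
  case True
  then have "curl_sym \<omega> = (\<lambda>x w. 0)" by (intro ext) (simp add: curl_sym_wavenumber_0 \<kappa>_def)
  then show ?thesis by (simp add: herm_def)
next
  case False
  let ?K = "curl_sym \<omega>"
  define a where "a = (g - 1) / \<kappa>\<^sup>2"
  have K3: "?K (?K (?K u)) = (\<lambda>w. of_real (\<kappa>\<^sup>2) * ?K u w)" for u
    unfolding \<kappa>_def by (rule ext) (rule curl_sym_cube)
  have 1: "herm (?K (?K x)) (?K x) = of_real (\<kappa>\<^sup>2) * herm x (?K x)"
    by (simp only: herm_curl_sym K3 herm_mult_right)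
  have 2: "herm (?K (?K x)) (?K (?K y)) = of_real (\<kappa>\<^sup>2) * herm x (?K (?K y))"
  proof -
    have "herm (?K (?K x)) (?K (?K y)) = herm (?K x) (?K (?K (?K y)))"
      by (simp only: herm_curl_sym)
    also have "\<dots> = of_real (\<kappa>\<^sup>2) * herm (?K x) (?K y)" by (simp only: K3 herm_mult_right)
    finally show ?thesis by (simp only: herm_curl_sym)
  qed
  have 3: "herm (?K y) (?K x) = herm y (?K (?K x))" by (rule herm_curl_sym)
  have 4: "herm (?K y) (?K (?K y)) = of_real (\<kappa>\<^sup>2) * herm y (?K y)"
    by (simp only: herm_curl_sym K3 herm_mult_right)
  have "herm (evolve r \<omega> \<tau> x y) (?K (evolve r \<omega> \<tau> x y)) =
    herm (\<lambda>w. x w + of_real a * ?K (?K x) w - of_real (r * b) * ?K y w)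
      (\<lambda>w. of_real g * ?K x w - of_real (r * b) * ?K (?K y) w)"
    unfolding curl_sym_evolve_reduced [abs_def]
    by (simp add: evolve_def Let_def a_def g_def b_def \<kappa>_def)
  also have "\<dots> = of_real (g + a * g * \<kappa>\<^sup>2) * herm x (?K x)
      - of_real (r * b + a * (r * b) * \<kappa>\<^sup>2) * herm x (?K (?K y))
      - of_real (r * b * g) * herm y (?K (?K x)) + of_real ((r * b) * (r * b) * \<kappa>\<^sup>2) * herm y (?K y)"
    unfolding herm_expand 1 2 3 4 by (simp add: algebra_simps)
  \<comment> \<open>The coefficients collapse by \<open>a * \<kappa>\<^sup>2 = g - 1\<close> and
    \<open>b * \<kappa> = sin (\<tau> * \<kappa>)\<close>.\<close>
  also have "g + a * g * \<kappa>\<^sup>2 = g\<^sup>2" using False by (simp add: a_def field_simps power2_eq_square)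
  also have "r * b + a * (r * b) * \<kappa>\<^sup>2 = r * g * b"
    using False by (simp add: a_def field_simps)
  also have "(r * b) * (r * b) * \<kappa>\<^sup>2 = r\<^sup>2 * (sin (\<tau> * \<kappa>))\<^sup>2"
    using False by (simp add: b_def field_simps power2_eq_square)
  finally show ?thesis by (simp add: algebra_simps)
qed

text \<open>The mixed terms carry \<open>- r\<close> in the first helicity and
  \<open>r\<^sup>2 * (1 / r)\<close> in the second, so they cancel. The squares of cosine and sine
  add up to 1.\<close>

lemma helicity_evolve_conserved:
  assumes "r \<noteq> 0"
  shows "herm (evolve r \<omega> \<tau> x y) (curl_sym \<omega> (evolve r \<omega> \<tau> x y))
    + of_real (r\<^sup>2) * herm (evolve (- 1 / r) \<omega> \<tau> y x) (curl_sym \<omega> (evolve (- 1 / r) \<omega> \<tau> y x))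
    = herm x (curl_sym \<omega> x) + of_real (r\<^sup>2) * herm y (curl_sym \<omega> y)"
proof -
  let ?s = "sin (\<tau> * wavenumber \<omega>)" and ?g = "cos (\<tau> * wavenumber \<omega>)"
  have *: "(of_real (g\<^sup>2) * A + of_real (r\<^sup>2 * s\<^sup>2) * B - of_real (r * g * b) * (C + D))
    + of_real (r\<^sup>2) * (of_real (g\<^sup>2) * B + of_real ((- 1 / r)\<^sup>2 * s\<^sup>2) * A - of_real ((- 1 / r) * g * b) * (D + C))
    = of_real (g\<^sup>2 + s\<^sup>2) * (A + of_real (r\<^sup>2) * B)" for g s b and A B C D :: complex
    using assms by (simp add: field_simps power2_eq_square)
  show ?thesis
    unfolding helicity_evolve * by simp
qed

text \<open>Maxwell's equations for one mode: differentiation exchanges cosine and sine, and by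
  \<open>curl_sym_evolve_reduced\<close> the result is the symbol applied to the partner
  field.\<close>

lemma evolve_has_vector_derivative:
  assumes "r \<noteq> 0" "s \<noteq> 0"
  shows "((\<lambda>t. evolve r \<omega> (t / s) x y w) has_vector_derivative
    of_real (- r / s) * curl_sym \<omega> (evolve (- 1 / r) \<omega> (t / s) y x) w) (at t within S)"
proof (cases "wavenumber \<omega> = 0")
  case True
  then show ?thesis by (simp add: evolve_def curl_sym_wavenumber_0)
next
  case False
  define \<kappa> where "\<kappa> = wavenumber \<omega>"
  have c: "((\<lambda>t. (cos (t / s * \<kappa>) - 1) / \<kappa>\<^sup>2) has_real_derivative - (sin (t / s * \<kappa>) / \<kappa>) / s) (at t within S)"
    using False assms(2) by (auto intro!: derivative_eq_intros simp: power2_eq_square \<kappa>_def)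
  have s: "((\<lambda>t. r * (sin (t / s * \<kappa>) / \<kappa>)) has_real_derivative r * cos (t / s * \<kappa>) / s) (at t within S)"
    using False assms(2) by (auto intro!: derivative_eq_intros simp: \<kappa>_def)
  have "((\<lambda>t. evolve r \<omega> (t / s) x y w) has_vector_derivative
     0 + of_real (- (sin (t / s * \<kappa>) / \<kappa>) / s) * curl_sym \<omega> (curl_sym \<omega> x) w
     - of_real (r * cos (t / s * \<kappa>) / s) * curl_sym \<omega> y w) (at t within S)"
    unfolding evolve_def Let_def \<kappa>_def [symmetric]
    by (intro has_vector_derivative_diff has_vector_derivative_add has_vector_derivative_const
      has_vector_derivative_mult_left has_vector_derivative_of_real)
      (use c s in \<open>simp_all\<close>)
  moreover have "0 + of_real (- (sin (t / s * \<kappa>) / \<kappa>) / s) * curl_sym \<omega> (curl_sym \<omega> x) w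
     - of_real (r * cos (t / s * \<kappa>) / s) * curl_sym \<omega> y w
     = of_real (- r / s) * curl_sym \<omega> (evolve (- 1 / r) \<omega> (t / s) y x) w"
    using assms unfolding curl_sym_evolve_reduced \<kappa>_def by (simp add: field_simps)
  ultimately show ?thesis by simp
qed


section \<open>The scheme in Fourier space\<close>

lemma npts_kron: "N zdir * (N ydir * N xdir) = npts N"
  by (simp add: npts_def)

section \<open>The transform and the derivatives in three dimensions\<close>

lemma idft3_carrier [simp]: "idft3 N \<in> carrier_mat (npts N) (npts N)"
  and dft3_carrier [simp]: "dft3 N \<in> carrier_mat (npts N) (npts N)"
  unfolding idft3_def dft3_def npts_kron [symmetric] by (intro kron_carrier; simp)+

lemma lift_axis_carrier [simp]:
  assumes "M \<in> carrier_mat (N w) (N w)"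
  shows "lift_axis N w M \<in> carrier_mat (npts N) (npts N)"
  using assms unfolding npts_kron [symmetric]
  by (cases w) (auto simp: lift_axis_def simp del: carrier_matI intro!: kron_carrier)

lemma lift_axis_smult: "lift_axis N w (a \<cdot>\<^sub>m M) = a \<cdot>\<^sub>m lift_axis N w M"
  by (cases w) (simp_all add: lift_axis_def kron_smult_left kron_smult_right)

text \<open>A suitable \<open>g\<close> takes a flattened index to its coordinate along
  \<open>w\<close>. Existence suffices to see that the entries of \<open>Om\<close> are
  real.\<close>

lemma lift_axis_mat_diag:
  "\<exists>g. lift_axis N w (mat_diag (N w) f) = mat_diag (npts N) (\<lambda>i. f (g i))"
  unfolding npts_kron [symmetric]
  by (cases w) (auto simp: lift_axis_def kron_mat_diag simp flip: mat_diag_one)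

text \<open>By the mixed-product rule the identities in the other two directions pass through their
  transforms, and \<open>AB\<close> settles direction \<open>w\<close>.\<close>

lemma lift_axis_idft3:
  assumes A: "A \<in> carrier_mat (N w) (N w)" and B: "B \<in> carrier_mat (N w) (N w)"
    and AB: "A * idft (N w) = idft (N w) * B"
  shows "lift_axis N w A * idft3 N = idft3 N * lift_axis N w B"
proof -
  let ?x = "N xdir" and ?y = "N ydir" and ?z = "N zdir"
  note kron_carrier [where m = ?y and n = ?y and p = ?x and q = ?x, simp]
  note [simp] = kron_mult [where m = ?z and n = ?z and p = "?y * ?x" and q = "?y * ?x"
      and r = ?z and s = "?y * ?x"]
    kron_mult [where m = ?y and n = ?y and p = ?x and q = ?x and r = ?y and s = ?x]
  show ?thesis
    using assms
    by (cases w) (simp_all add: lift_axis_def idft3_def left_mult_one_mat [OF idft_carrier]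
      right_mult_one_mat [OF idft_carrier])
qed

text \<open>The adjoint of each factor is \<open>dft\<close> over its length, so the adjoint of
  \<open>idft3 N\<close> is \<open>dft3 N\<close> over \<open>npts N\<close>, and
  \<open>dft3 N * idft3 N\<close> is the identity.\<close>

lemma idft3_isometry:
  assumes "\<And>w. N w > 0"
  shows "map_mat cnj (idft3 N)\<^sup>T * idft3 N = complex_of_real (1 / npts N) \<cdot>\<^sub>m 1\<^sub>m (npts N)"
proof -
  let ?x = "N xdir" and ?y = "N ydir" and ?z = "N zdir"
  have "map_mat cnj (idft3 N)\<^sup>T = complex_of_real (1 / npts N) \<cdot>\<^sub>m dft3 N"
    unfolding idft3_def dft3_def kron_adjoint idft_adjoint kron_smult_left kron_smult_right npts_def
    by (rule eq_matI) (auto simp: field_simps)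
  moreover have "dft3 N * idft3 N = 1\<^sub>m (npts N)"
    unfolding dft3_def idft3_def
    using assms
    by (simp add: kron_mult [where m = ?z and n = ?z and p = "?y * ?x" and q = "?y * ?x"
      and r = ?z and s = "?y * ?x"]
      kron_mult [where m = ?y and n = ?y and p = ?x and q = ?x and r = ?y and s = ?x]
      dft_idft kron_one_one npts_kron)
  ultimately show ?thesis
    by (simp add: mult_smult_assoc_mat [OF dft3_carrier idft3_carrier])
qed

text \<open>Taking the real part loses nothing, as \<open>Om_eq\<close> shows; it gives
  \<open>curl_sym\<close> the real wave vector that makes it Hermitian.\<close>

definition mode_freq :: "(axis \<Rightarrow> nat) \<Rightarrow> (axis \<Rightarrow> real) \<Rightarrow> (axis \<Rightarrow> real) \<Rightarrow> nat \<Rightarrow> axis \<Rightarrow> real" where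
  "mode_freq N L R i w = Re (Om N L R w $$ (i, i))"

lemma Om_eq: "Om N L R w = mat_diag (npts N) (\<lambda>i. of_real (mode_freq N L R i w))"
proof -
  obtain g where g: "Om N L R w = mat_diag (npts N) (\<lambda>i. complex_of_real (nu L R w) * fourier_freq (N w) (g i))"
    using lift_axis_mat_diag unfolding Om_def freq_mat_eq by blast
  have "Im (fourier_freq (N w) k) = 0" for k
    by (simp add: fourier_freq_def)
  then show ?thesis
    unfolding g by (auto simp: mat_diag_def mode_freq_def g complex_eq_iff)
qed

lemma mult_idft3_diff_mat:
  assumes "\<And>w. N w > 0" "\<And>w. even (N w)" "\<And>w. L w < R w"
  shows "lift_axis N w (diff_mat N L R w) *\<^sub>v (idft3 N *\<^sub>v vec (npts N) f) =
    idft3 N *\<^sub>v vec (npts N) (\<lambda>i. \<i> * of_real (mode_freq N L R i w) * f i)"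
proof -
  have D: "diff_mat N L R w \<in> carrier_mat (N w) (N w)" by (simp add: diff_mat_def)
  have Q: "\<i> \<cdot>\<^sub>m freq_mat N L R w \<in> carrier_mat (N w) (N w)" by (simp add: freq_mat_eq)
  have "lift_axis N w (diff_mat N L R w) * idft3 N = idft3 N * lift_axis N w (\<i> \<cdot>\<^sub>m freq_mat N L R w)"
    by (rule lift_axis_idft3 [of _ N w, OF D Q diff_mat_idft [of N w L R, OF assms]])
  also have "lift_axis N w (\<i> \<cdot>\<^sub>m freq_mat N L R w) =
      mat_diag (npts N) (\<lambda>i. \<i> * of_real (mode_freq N L R i w))"
    by (simp add: lift_axis_smult smult_mat_diag Om_eq flip: Om_def)
  finally have "lift_axis N w (diff_mat N L R w) * idft3 N =
      idft3 N * mat_diag (npts N) (\<lambda>i. \<i> * of_real (mode_freq N L R i w))" .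
  moreover have "lift_axis N w (diff_mat N L R w) *\<^sub>v (idft3 N *\<^sub>v vec (npts N) f)
      = (lift_axis N w (diff_mat N L R w) * idft3 N) *\<^sub>v vec (npts N) f"
    by (rule assoc_mult_mat_vec [symmetric, OF lift_axis_carrier [of _ N w, OF D] idft3_carrier]) simp
  moreover have "(idft3 N * mat_diag (npts N) g) *\<^sub>v vec (npts N) f
      = idft3 N *\<^sub>v (mat_diag (npts N) g *\<^sub>v vec (npts N) f)" for g
    by (rule assoc_mult_mat_vec [OF idft3_carrier mat_diag_dim]) simp
  ultimately show ?thesis
    by (simp add: mat_diag_mult_vec) (rule arg_cong [where f = "\<lambda>v. idft3 N *\<^sub>v v"], auto)
qed

section \<open>Curl and inner product in terms of Fourier coefficients\<close>

lemma mult_mat_vec_index: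
  assumes "A \<in> carrier_mat n n" "k < n"
  shows "(A *\<^sub>v vec n f) $ k = (\<Sum>j<n. A $$ (k, j) * f j)"
  using assms by (auto simp: scalar_prod_def atLeast0LessThan)

text \<open>Each block is a lifted derivative up to sign, or zero, and a derivative multiplies the
  coefficients by \<open>\<i>\<close> times the frequency.\<close>

lemma curl_mat_idft3:
  assumes "\<And>w. N w > 0" "\<And>w. even (N w)" "\<And>w. L w < R w"
  shows "curl_mat N L R *\<^sub>v stack3 (\<lambda>w. idft3 N *\<^sub>v vec (npts N) (u w)) =
    stack3 (\<lambda>w. idft3 N *\<^sub>v vec (npts N) (\<lambda>i. curl_sym (mode_freq N L R i) (\<lambda>w. u w i) w))"
proof (rule stack3_eqI)
  let ?n = "npts N"
  show "dim_vec (curl_mat N L R *\<^sub>v stack3 (\<lambda>w. idft3 N *\<^sub>v vec ?n (u w))) = 3 * ?n"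
    by (simp add: curl_mat_def block3_def Let_def)
  fix w
  let ?D = "\<lambda>w. lift_axis N w (diff_mat N L R w)"
  have D: "?D w \<in> carrier_mat ?n ?n" for w
    by (intro lift_axis_carrier) (simp add: diff_mat_def)
  have dimF: "dim_vec (idft3 N *\<^sub>v v) = ?n" for v
    using idft3_carrier [of N] by (simp only: dim_mult_mat_vec carrier_matD)
  have dimu: "dim_vec (stack3 (\<lambda>w. idft3 N *\<^sub>v vec ?n (u w))) = 3 * ?n"
    by (rule dim_stack3) (rule dimF)
  have neg: "- ?D w *\<^sub>v (idft3 N *\<^sub>v v) = - (?D w *\<^sub>v (idft3 N *\<^sub>v v))" for w v
    using D [of w] by (intro uminus_mult_mat_vec) (simp only: dimF carrier_matD)
  have zero: "0\<^sub>m ?n ?n *\<^sub>v (idft3 N *\<^sub>v v) = 0\<^sub>v ?n" for v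
    by (rule eq_vecI) (simp_all add: scalar_prod_def carrier_matD [OF idft3_carrier])
  have "comp3 ?n (curl_mat N L R *\<^sub>v stack3 (\<lambda>w. idft3 N *\<^sub>v vec ?n (u w))) w =
     ([[0\<^sub>m ?n ?n, - ?D zdir, ?D ydir], [?D zdir, 0\<^sub>m ?n ?n, - ?D xdir], [- ?D ydir, ?D xdir, 0\<^sub>m ?n ?n]]
       ! axis_index w ! 0) *\<^sub>v (idft3 N *\<^sub>v vec ?n (u xdir))
   + ([[0\<^sub>m ?n ?n, - ?D zdir, ?D ydir], [?D zdir, 0\<^sub>m ?n ?n, - ?D xdir], [- ?D ydir, ?D xdir, 0\<^sub>m ?n ?n]]
       ! axis_index w ! 1) *\<^sub>v (idft3 N *\<^sub>v vec ?n (u ydir))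
   + ([[0\<^sub>m ?n ?n, - ?D zdir, ?D ydir], [?D zdir, 0\<^sub>m ?n ?n, - ?D xdir], [- ?D ydir, ?D xdir, 0\<^sub>m ?n ?n]]
       ! axis_index w ! 2) *\<^sub>v (idft3 N *\<^sub>v vec ?n (u zdir))"
    unfolding curl_mat_def Let_def
    by (subst comp3_block3_mult [OF dimu])
      (use D in \<open>auto simp: comp3_stack3 [OF dimF] less_Suc_eq eval_nat_numeral\<close>)
  also have "\<dots> = idft3 N *\<^sub>v vec ?n (\<lambda>i. curl_sym (mode_freq N L R i) (\<lambda>w. u w i) w)"
    by (rule eq_vecI; cases w)
      (simp_all add: neg zero mult_idft3_diff_mat assms mult_mat_vec_index [OF idft3_carrier] dimF
        carrier_matD [OF idft3_carrier] sum_subtractf right_diff_distrib mult_ac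
        del: index_mult_mat_vec)
  finally show "comp3 ?n (curl_mat N L R *\<^sub>v stack3 (\<lambda>w. idft3 N *\<^sub>v vec ?n (u w))) w =
    idft3 N *\<^sub>v vec ?n (\<lambda>i. curl_sym (mode_freq N L R i) (\<lambda>w. u w i) w)" .
qed

text \<open>Parseval's identity. One factor \<open>1 / npts N\<close> comes from
  \<open>inner_N\<close>, the other from \<open>idft3_isometry\<close>.\<close>

lemma inner_N_idft3:
  assumes "\<And>w. N w > 0"
  shows "inner_N N (stack3 (\<lambda>w. idft3 N *\<^sub>v vec (npts N) (u w)))
      (stack3 (\<lambda>w. idft3 N *\<^sub>v vec (npts N) (v w)))
    = complex_of_real (1 / (npts N)\<^sup>2) * (\<Sum>i<npts N. herm (\<lambda>w. u w i) (\<lambda>w. v w i))"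
proof -
  have dimF: "dim_vec (idft3 N *\<^sub>v v) = npts N" for v
    using idft3_carrier [of N] by (simp only: dim_mult_mat_vec carrier_matD)
  have *: "(idft3 N *\<^sub>v vec (npts N) f) \<bullet>c (idft3 N *\<^sub>v vec (npts N) g)
      = complex_of_real (1 / npts N) * (\<Sum>i<npts N. f i * cnj (g i))" for f g
    by (subst scalar_prod_isometry [OF idft3_carrier idft3_isometry])
      (auto simp: assms scalar_prod_def atLeast0LessThan)
  then show ?thesis
    unfolding inner_N_def stack3_scalar_prod [OF dimF dimF] *
    by (simp add: herm_def sum.distrib power2_eq_square add_divide_distrib)
qed

lemma helicity_idft3:
  assumes "\<And>w. N w > 0" "\<And>w. even (N w)" "\<And>w. L w < R w"
  shows "helicity N L R \<epsilon> \<mu> (stack3 (\<lambda>w. idft3 N *\<^sub>v vec (npts N) (\<lambda>i. e i w)))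
      (stack3 (\<lambda>w. idft3 N *\<^sub>v vec (npts N) (\<lambda>i. h i w))) =
    complex_of_real (1 / (npts N)\<^sup>2) * (\<Sum>i<npts N.
      of_real (1 / (2 * \<epsilon>)) * herm (h i) (curl_sym (mode_freq N L R i) (h i))
      + of_real (1 / (2 * \<mu>)) * herm (e i) (curl_sym (mode_freq N L R i) (e i)))"
  unfolding helicity_def curl_mat_idft3 [of N L R, OF assms] inner_N_idft3 [of N, OF assms(1)]
  by (simp add: sum.distrib sum_distrib_left algebra_simps)

section \<open>The propagator as cosine and sine of the curl symbol\<close>

lemma Psi_mat_index:
  assumes "i < npts N"
  shows "Psi_mat N L R \<tau> $$ (i, i) = of_real ((\<tau> * wavenumber (mode_freq N L R i))\<^sup>2)"
  using assms unfolding Psi_mat_def Om_eq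
  by (simp add: mat_diag_pow2 add_mat_diag smult_mat_diag power_mult_distrib wavenumber_square)
    (simp add: mat_diag_def)

text \<open>The principal root brings in the absolute value, which disappears again in the even
  functions \<open>cos x\<close> and \<open>sin x / x\<close>.\<close>

lemma csqrt_minus_square: "csqrt (- of_real (x\<^sup>2)) = \<i> * of_real \<bar>x\<bar>"
  by (subst csqrt_of_real_nonpos) auto

lemma cosh_imaginary: "cosh (\<i> * of_real x) = complex_of_real (cos x)"
  and sinh_imaginary: "sinh (\<i> * of_real x) = \<i> * complex_of_real (sin x)"
  by (simp_all add: cosh_def sinh_def complex_eq_iff Re_exp Im_exp)

text \<open>Restricted to nonzero wavenumber: at 0 the continuous value \<open>- 1 / 2\<close> and
  the quotient on the right, which is 0 there, disagree in general.\<close>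

lemma A_mat_eq:
  obtains \<alpha> where "A_mat N L R \<tau> = mat_diag (npts N) \<alpha>"
    and "\<And>i. i < npts N \<Longrightarrow> wavenumber (mode_freq N L R i) \<noteq> 0 \<Longrightarrow> of_real (\<tau>\<^sup>2) * \<alpha> i =
      of_real ((cos (\<tau> * wavenumber (mode_freq N L R i)) - 1) / (wavenumber (mode_freq N L R i))\<^sup>2)"
proof (rule that [OF A_mat_def])
  fix i
  assume i: "i < npts N" and k: "wavenumber (mode_freq N L R i) \<noteq> 0"
  have "cosh (csqrt (- of_real ((\<tau> * wavenumber (mode_freq N L R i))\<^sup>2))) =
      complex_of_real (cos (\<tau> * wavenumber (mode_freq N L R i)))"
    unfolding csqrt_minus_square cosh_imaginary by (simp add: cos_abs_real)
  \<comment> \<open>At \<open>\<tau> = 0\<close> the entry of \<open>\<Psi>\<close> vanishes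
    although the wavenumber does not; both sides are then 0.\<close>
  then show "of_real (\<tau>\<^sup>2) * (let \<psi> = Psi_mat N L R \<tau> $$ (i, i) in
        if \<psi> = 0 then - 1 / 2 else (cosh (csqrt (- \<psi>)) - 1) / \<psi>) =
      of_real ((cos (\<tau> * wavenumber (mode_freq N L R i)) - 1) / (wavenumber (mode_freq N L R i))\<^sup>2)"
    using k unfolding Let_def Psi_mat_index [OF i]
    by (cases "\<tau> = 0") (auto simp: power_mult_distrib)
qed

lemma B_mat_eq:
  obtains \<beta> where "B_mat N L R \<tau> = mat_diag (npts N) \<beta>"
    and "\<And>i. i < npts N \<Longrightarrow> wavenumber (mode_freq N L R i) \<noteq> 0 \<Longrightarrow> of_real \<tau> * \<beta> i =
      of_real (sin (\<tau> * wavenumber (mode_freq N L R i)) / wavenumber (mode_freq N L R i))"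
proof (rule that [OF B_mat_def])
  fix i
  assume i: "i < npts N" and k: "wavenumber (mode_freq N L R i) \<noteq> 0"
  have "sinh (csqrt (- of_real ((\<tau> * wavenumber (mode_freq N L R i))\<^sup>2)))
      / csqrt (- of_real ((\<tau> * wavenumber (mode_freq N L R i))\<^sup>2)) =
      complex_of_real (sin (\<tau> * wavenumber (mode_freq N L R i)) / (\<tau> * wavenumber (mode_freq N L R i)))"
    unfolding csqrt_minus_square sinh_imaginary by (simp add: abs_if)
  then show "of_real \<tau> * (let \<psi> = Psi_mat N L R \<tau> $$ (i, i) in
        if \<psi> = 0 then 1 else sinh (csqrt (- \<psi>)) / csqrt (- \<psi>)) =
      of_real (sin (\<tau> * wavenumber (mode_freq N L R i)) / wavenumber (mode_freq N L R i))"
    using k unfolding Let_def Psi_mat_index [OF i]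
    by (cases "\<tau> = 0") (auto simp: power_mult_distrib)
qed

text \<open>The blocks of \<open>c_mat\<close> are those of
  \<open>I + \<tau>\<^sup>2 A K\<^sup>2\<close> with \<open>K\<close> the curl symbol, whose square
  has diagonal entries such as \<open>\<omega>\<^sub>2\<^sup>2 + \<omega>\<^sub>3\<^sup>2\<close>
  and off-diagonal ones such as \<open>- \<omega>\<^sub>1 \<omega>\<^sub>2\<close>.\<close>

lemma comp3_c_mat:
  assumes v: "dim_vec v = 3 * npts N"
  shows "comp3 (npts N) (c_mat N L R \<tau> *\<^sub>v v) w = vec (npts N) (\<lambda>i.
    let \<kappa> = wavenumber (mode_freq N L R i); x = (\<lambda>w. comp3 (npts N) v w $ i) in
      x w + of_real ((cos (\<tau> * \<kappa>) - 1) / \<kappa>\<^sup>2) * curl_sym (mode_freq N L R i) (curl_sym (mode_freq N L R i) x) w)"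
proof -
  let ?n = "npts N" and ?O = "mode_freq N L R"
  obtain \<alpha> where A: "A_mat N L R \<tau> = mat_diag ?n \<alpha>"
    and \<alpha>: "\<And>i. i < ?n \<Longrightarrow> wavenumber (?O i) \<noteq> 0 \<Longrightarrow> of_real (\<tau>\<^sup>2) * \<alpha> i =
      of_real ((cos (\<tau> * wavenumber (?O i)) - 1) / (wavenumber (?O i))\<^sup>2)"
    using A_mat_eq by blast
  have dimc: "dim_vec (comp3 ?n v w) = ?n" for w by (simp add: comp3_def)
  have *: "of_real (\<tau>\<^sup>2) * \<alpha> i * curl_sym (?O i) (curl_sym (?O i) x) w =
      of_real ((cos (\<tau> * wavenumber (?O i)) - 1) / (wavenumber (?O i))\<^sup>2) * curl_sym (?O i) (curl_sym (?O i) x) w"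
    if "i < ?n" for i x w
    using \<alpha> [OF that] by (cases "wavenumber (?O i) = 0") (simp_all add: curl_sym_wavenumber_0)
  have "comp3 ?n (c_mat N L R \<tau> *\<^sub>v v) w = vec ?n (\<lambda>i. let x = (\<lambda>w. comp3 ?n v w $ i) in
      x w + of_real (\<tau>\<^sup>2) * \<alpha> i * curl_sym (?O i) (curl_sym (?O i) x) w)"
    unfolding c_mat_def Let_def A Om_eq mat_diag_one [symmetric] mat_diag_pow2 mat_diag_diag
      add_mat_diag smult_mat_diag
    by (subst comp3_block3_mult [OF v];
      (rule eq_vecI; cases w)?)
      (auto simp: mat_diag_mult_vec [OF dimc] dimc less_Suc_eq eval_nat_numeral
        algebra_simps power2_eq_square)
  also have "\<dots> = vec ?n (\<lambda>i. let \<kappa> = wavenumber (?O i); x = (\<lambda>w. comp3 ?n v w $ i) in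
      x w + of_real ((cos (\<tau> * \<kappa>) - 1) / \<kappa>\<^sup>2) * curl_sym (?O i) (curl_sym (?O i) x) w)"
    unfolding Let_def by (intro eq_vecI) (simp_all only: dim_vec index_vec *)
  finally show ?thesis .
qed

text \<open>The blocks of \<open>s_mat\<close> are those of \<open>\<tau> B K\<close>: the signs
  form the cross product matrix.\<close>

lemma comp3_s_mat:
  assumes v: "dim_vec v = 3 * npts N"
  shows "comp3 (npts N) (s_mat N L R \<tau> *\<^sub>v v) w = vec (npts N) (\<lambda>i.
    let \<kappa> = wavenumber (mode_freq N L R i); x = (\<lambda>w. comp3 (npts N) v w $ i) in
      of_real (sin (\<tau> * \<kappa>) / \<kappa>) * curl_sym (mode_freq N L R i) x w)"
proof -
  let ?n = "npts N" and ?O = "mode_freq N L R"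
  obtain \<beta> where B: "B_mat N L R \<tau> = mat_diag ?n \<beta>"
    and \<beta>: "\<And>i. i < ?n \<Longrightarrow> wavenumber (?O i) \<noteq> 0 \<Longrightarrow> of_real \<tau> * \<beta> i =
      of_real (sin (\<tau> * wavenumber (?O i)) / wavenumber (?O i))"
    using B_mat_eq by blast
  have dimc: "dim_vec (comp3 ?n v w) = ?n" for w by (simp add: comp3_def)
  have *: "of_real \<tau> * \<beta> i * curl_sym (?O i) x w =
      of_real (sin (\<tau> * wavenumber (?O i)) / wavenumber (?O i)) * curl_sym (?O i) x w"
    if "i < ?n" for i x w
    using \<beta> [OF that] by (cases "wavenumber (?O i) = 0") (simp_all add: curl_sym_wavenumber_0)
  have "comp3 ?n (s_mat N L R \<tau> *\<^sub>v v) w = vec ?n (\<lambda>i. let x = (\<lambda>w. comp3 ?n v w $ i) in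
      of_real \<tau> * \<beta> i * curl_sym (?O i) x w)"
    unfolding s_mat_def Let_def B Om_eq zero_mat_diag mat_diag_diag smult_mat_diag uminus_mat_diag
    by (subst comp3_block3_mult [OF v];
      (rule eq_vecI; cases w)?)
      (auto simp: mat_diag_mult_vec [OF dimc] dimc less_Suc_eq eval_nat_numeral algebra_simps)
  also have "\<dots> = vec ?n (\<lambda>i. let \<kappa> = wavenumber (?O i); x = (\<lambda>w. comp3 ?n v w $ i) in
      of_real (sin (\<tau> * \<kappa>) / \<kappa>) * curl_sym (?O i) x w)"
    unfolding Let_def by (intro eq_vecI) (simp_all only: dim_vec index_vec *)
  finally show ?thesis .
qed


section \<open>Conservation of the helicities\<close>

definition init_mode :: "(axis \<Rightarrow> nat) \<Rightarrow> (axis \<Rightarrow> real) \<Rightarrow> (axis \<Rightarrow> real) \<Rightarrow> init_field \<Rightarrow> nat \<Rightarrow> axis \<Rightarrow> complex" where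
  "init_mode N L R F0 i w = comp3 (npts N) (hat0 N L R F0) w $ i"

definition mode_sol :: "(axis \<Rightarrow> nat) \<Rightarrow> (axis \<Rightarrow> real) \<Rightarrow> (axis \<Rightarrow> real) \<Rightarrow> real \<Rightarrow> real \<Rightarrow>
    init_field \<Rightarrow> init_field \<Rightarrow> real \<Rightarrow> nat \<Rightarrow> axis \<Rightarrow> complex" where
  "mode_sol N L R r s X0 Y0 t i =
     evolve r (mode_freq N L R i) (t / s) (init_mode N L R X0 i) (init_mode N L R Y0 i)"

lemma dim_hat0: "dim_vec (hat0 N L R F0) = 3 * npts N"
  unfolding hat0_def by (rule dim_stack3) (simp add: carrier_matD [OF dft3_carrier])

lemma dim_c_mat [simp]: "dim_row (c_mat N L R \<tau>) = 3 * npts N"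
  and dim_s_mat [simp]: "dim_row (s_mat N L R \<tau>) = 3 * npts N"
  by (simp_all add: c_mat_def s_mat_def Let_def block3_def)

text \<open>Serves both fields: the plus sign in the electric update is the case of negative
  \<open>b\<close>.\<close>

lemma comp3_propagator:
  assumes "a \<noteq> 0"
  shows "comp3 (npts N) (complex_of_real (1 / a) \<cdot>\<^sub>v (complex_of_real a \<cdot>\<^sub>v (c_mat N L R (t / s) *\<^sub>v hat0 N L R X0)
      - complex_of_real b \<cdot>\<^sub>v (s_mat N L R (t / s) *\<^sub>v hat0 N L R Y0))) w
    = vec (npts N) (\<lambda>i. mode_sol N L R (b / a) s X0 Y0 t i w)"
    (is "comp3 ?n ?v w = _")
proof (rule eq_vecI)
  fix i assume "i < dim_vec (vec ?n (\<lambda>i. mode_sol N L R (b / a) s X0 Y0 t i w))"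
  then have i: "i < ?n" by simp
  have lt: "axis_index w * ?n + i < 3 * ?n" using i by (cases w) auto
  let ?C = "c_mat N L R (t / s) *\<^sub>v hat0 N L R X0" and ?S = "s_mat N L R (t / s) *\<^sub>v hat0 N L R Y0"
  have "comp3 ?n ?v w $ i = complex_of_real (1 / a) * (complex_of_real a * comp3 ?n ?C w $ i
      - complex_of_real b * comp3 ?n ?S w $ i)"
    using i lt by (simp add: comp3_def del: index_mult_mat_vec)
  also have "\<dots> = mode_sol N L R (b / a) s X0 Y0 t i w"
    using assms i unfolding comp3_c_mat [OF dim_hat0] comp3_s_mat [OF dim_hat0]
    by (simp add: mode_sol_def evolve_def init_mode_def [abs_def] Let_def field_simps)
  finally show "comp3 ?n ?v w $ i = vec ?n (\<lambda>i. mode_sol N L R (b / a) s X0 Y0 t i w) $ i"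
    using i by simp
qed (simp add: comp3_def)

lemma H_sol_eq:
  assumes "\<mu> > 0"
  shows "H_sol N L R \<epsilon> \<mu> E0 H0 t = stack3 (\<lambda>w. idft3 N *\<^sub>v vec (npts N)
    (\<lambda>i. mode_sol N L R (sqrt \<epsilon> / sqrt \<mu>) (sqrt (\<mu> * \<epsilon>)) H0 E0 t i w))"
  unfolding H_sol_def H_hat_def Let_def using assms by (subst comp3_propagator) auto

lemma E_sol_eq:
  assumes "\<epsilon> > 0"
  shows "E_sol N L R \<epsilon> \<mu> E0 H0 t = stack3 (\<lambda>w. idft3 N *\<^sub>v vec (npts N)
    (\<lambda>i. mode_sol N L R (- sqrt \<mu> / sqrt \<epsilon>) (sqrt (\<mu> * \<epsilon>)) E0 H0 t i w))"
proof -
  have "complex_of_real (sqrt \<epsilon>) \<cdot>\<^sub>v u + complex_of_real (sqrt \<mu>) \<cdot>\<^sub>v v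
      = complex_of_real (sqrt \<epsilon>) \<cdot>\<^sub>v u - complex_of_real (- sqrt \<mu>) \<cdot>\<^sub>v v" for u v
    by (rule eq_vecI) auto
  then show ?thesis
    unfolding E_sol_def E_hat_def Let_def using assms by (simp only:) (subst comp3_propagator; simp)
qed

text \<open>Every entry is a linear combination of mode coefficients with constant weights from
  \<open>F\<close>, so differentiation passes to the coefficients.\<close>

lemma time_deriv_stack3:
  assumes t: "t \<ge> 0" and F: "F \<in> carrier_mat n n"
    and deriv: "\<And>i w. i < n \<Longrightarrow> ((\<lambda>t. g t i w) has_vector_derivative g' i w) (at t within {0..})"
  shows "time_deriv (\<lambda>t. stack3 (\<lambda>w. F *\<^sub>v vec n (\<lambda>i. g t i w))) t = stack3 (\<lambda>w. F *\<^sub>v vec n (\<lambda>i. g' i w))"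
proof (rule stack3_eqI)
  have dimF: "dim_vec (F *\<^sub>v v) = n" for v using F by simp
  have dim: "dim_vec (stack3 (\<lambda>w. F *\<^sub>v vec n (\<lambda>i. g t i w))) = 3 * n" for t
    by (rule dim_stack3) (rule dimF)
  show "dim_vec (time_deriv (\<lambda>t. stack3 (\<lambda>w. F *\<^sub>v vec n (\<lambda>i. g t i w))) t) = 3 * n"
    by (simp add: time_deriv_def dim)
  fix w
  show "comp3 n (time_deriv (\<lambda>t. stack3 (\<lambda>w. F *\<^sub>v vec n (\<lambda>i. g t i w))) t) w =
      F *\<^sub>v vec n (\<lambda>i. g' i w)"
  proof (rule eq_vecI)
    fix k assume "k < dim_vec (F *\<^sub>v vec n (\<lambda>i. g' i w))"
    then have k: "k < n" unfolding dimF .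
    have lt: "axis_index w * n + k < 3 * n" using k by (cases w) auto
    \<comment> \<open>Uniqueness of the derivative needs \<open>t\<close> to be a limit point of the
      half-line, which includes the endpoint 0.\<close>
    have "at t within {0..} \<noteq> bot"
    proof -
      have "t islimpt {t..t + 1}" by (rule islimpt_Icc [THEN iffD2]) auto
      then have "t islimpt {0..}" by (rule islimpt_subset) (use t in auto)
      then show ?thesis by (simp add: trivial_limit_within)
    qed
    moreover have "((\<lambda>r. stack3 (\<lambda>w. F *\<^sub>v vec n (\<lambda>i. g r i w)) $ (axis_index w * n + k))
        has_vector_derivative (F *\<^sub>v vec n (\<lambda>i. g' i w)) $ k) (at t within {0..})"
      unfolding stack3_index [OF dimF k] mult_mat_vec_index [OF F k]
      by (intro has_vector_derivative_sum has_vector_derivative_mult_right deriv) simp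
    ultimately have "vector_derivative (\<lambda>r. stack3 (\<lambda>w. F *\<^sub>v vec n (\<lambda>i. g r i w)) $ (axis_index w * n + k))
        (at t within {0..}) = (F *\<^sub>v vec n (\<lambda>i. g' i w)) $ k"
      by (rule vector_derivative_within)
    then show "comp3 n (time_deriv (\<lambda>t. stack3 (\<lambda>w. F *\<^sub>v vec n (\<lambda>i. g t i w))) t) w $ k =
        (F *\<^sub>v vec n (\<lambda>i. g' i w)) $ k"
      using k lt by (simp add: comp3_def time_deriv_def dim)
  qed (simp only: comp3_def dimF dim_vec)
qed

lemma time_deriv_mode_sol:
  assumes "t \<ge> 0" "r \<noteq> 0" "s \<noteq> 0"
  shows "time_deriv (\<lambda>t. stack3 (\<lambda>w. idft3 N *\<^sub>v vec (npts N) (\<lambda>i. mode_sol N L R r s X0 Y0 t i w))) t =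
    stack3 (\<lambda>w. idft3 N *\<^sub>v vec (npts N) (\<lambda>i.
      of_real (- r / s) * curl_sym (mode_freq N L R i) (mode_sol N L R (- 1 / r) s Y0 X0 t i) w))"
  unfolding mode_sol_def
  by (intro time_deriv_stack3 idft3_carrier evolve_has_vector_derivative assms)

text \<open>The ratio \<open>r\<close> satisfies \<open>r\<^sup>2 = \<epsilon> / \<mu>\<close>, so
  dividing the conserved quantity by \<open>2 * \<epsilon>\<close> gives exactly the weights of
  \<open>helicity\<close>.\<close>

lemma weighted_helicity_evolve_conserved:
  assumes "\<epsilon> > 0" "\<mu> > 0"
  shows "of_real (1 / (2 * \<epsilon>)) * herm (evolve (sqrt \<epsilon> / sqrt \<mu>) \<omega> \<tau> x y)
        (curl_sym \<omega> (evolve (sqrt \<epsilon> / sqrt \<mu>) \<omega> \<tau> x y))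
    + of_real (1 / (2 * \<mu>)) * herm (evolve (- sqrt \<mu> / sqrt \<epsilon>) \<omega> \<tau> y x)
        (curl_sym \<omega> (evolve (- sqrt \<mu> / sqrt \<epsilon>) \<omega> \<tau> y x))
    = of_real (1 / (2 * \<epsilon>)) * herm x (curl_sym \<omega> x) + of_real (1 / (2 * \<mu>)) * herm y (curl_sym \<omega> y)"
proof -
  define r where "r = sqrt \<epsilon> / sqrt \<mu>"
  have r: "r \<noteq> 0" "r\<^sup>2 = \<epsilon> / \<mu>" "- sqrt \<mu> / sqrt \<epsilon> = - 1 / r"
    using assms by (auto simp: r_def power_divide)
  have *: "of_real (1 / (2 * \<epsilon>)) * a + of_real (1 / (2 * \<mu>)) * b
      = of_real (1 / (2 * \<epsilon>)) * (a + of_real (r\<^sup>2) * b)" for a b :: complex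
    using assms by (simp add: r field_simps)
  show ?thesis
    unfolding r(3) r_def [symmetric] * helicity_evolve_conserved [OF r(1)] ..
qed

theorem theorem4p3:
  fixes N :: "axis \<Rightarrow> nat" and L R :: "axis \<Rightarrow> real"
    and \<epsilon> \<mu> t_end :: real
    and E0 H0 :: "axis \<Rightarrow> real \<Rightarrow> real \<Rightarrow> real \<Rightarrow> real"
  assumes "\<And>w. N w > 0" and "\<And>w. even (N w)"
    and "\<And>w. L w < R w"
    and "\<epsilon> > 0" and "\<mu> > 0" and "t_end \<ge> 0"
  shows "helicity1 N L R \<epsilon> \<mu> E0 H0 t_end = helicity1 N L R \<epsilon> \<mu> E0 H0 0
       \<and> helicity2 N L R \<epsilon> \<mu> E0 H0 t_end = helicity2 N L R \<epsilon> \<mu> E0 H0 0"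
proof -
  note grid = assms(1-3)
  define s where "s = sqrt (\<mu> * \<epsilon>)"
  define r where "r = sqrt \<epsilon> / sqrt \<mu>"
  define q where "q = - sqrt \<mu> / sqrt \<epsilon>"
  have s: "s \<noteq> 0" and rq: "r \<noteq> 0" "q \<noteq> 0" "- 1 / r = q" "- 1 / q = r"
    using assms by (auto simp: s_def r_def q_def)
  have squares: "(- r / s)\<^sup>2 = 1 / \<mu>\<^sup>2" "(- q / s)\<^sup>2 = 1 / \<epsilon>\<^sup>2"
    using assms by (simp_all add: r_def q_def s_def power_divide power_mult_distrib)
      (simp_all add: power2_eq_square)
  let ?x = "init_mode N L R H0" and ?y = "init_mode N L R E0"
  let ?K = "\<lambda>i. curl_sym (mode_freq N L R i)"
  note H = H_sol_eq [where \<epsilon> = \<epsilon>, OF assms(5), folded s_def r_def]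
    and E = E_sol_eq [where \<mu> = \<mu>, OF assms(4), folded s_def q_def]
  \<comment> \<open>The right side depends on the initial modes alone, not on
    \<open>t\<close>.\<close>
  have h1: "helicity1 N L R \<epsilon> \<mu> E0 H0 t = of_real (1 / (npts N)\<^sup>2) * (\<Sum>i<npts N.
      of_real (1 / (2 * \<epsilon>)) * herm (?x i) (?K i (?x i)) + of_real (1 / (2 * \<mu>)) * herm (?y i) (?K i (?y i)))" for t
    unfolding helicity1_def H E helicity_idft3 [of N L R, OF grid]
    unfolding mode_sol_def r_def q_def
    by (simp only: weighted_helicity_evolve_conserved [OF assms(4,5)])
  have h2: "helicity2 N L R \<epsilon> \<mu> E0 H0 t = of_real (1 / (npts N)\<^sup>2) * (\<Sum>i<npts N. of_real (1 / (\<epsilon> * \<mu>)) *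
      (of_real (1 / (2 * \<epsilon>)) * herm (?K i (?x i)) (?K i (?K i (?x i)))
       + of_real (1 / (2 * \<mu>)) * herm (?K i (?y i)) (?K i (?K i (?y i)))))" if t: "t \<ge> 0" for t
  proof -
    \<comment> \<open>The derivative of \<open>H\<close> is built from the electric modes and vice
      versa. Pulling out \<open>1 / (\<epsilon> * \<mu>)\<close> exchanges the two weights
      accordingly, so that the conservation law for \<open>evolve\<close> applies again.\<close>
    have swap: "of_real (1 / (2 * \<epsilon>)) * (of_real ((- r / s)\<^sup>2) * a) + of_real (1 / (2 * \<mu>)) * (of_real ((- q / s)\<^sup>2) * b)
        = of_real (1 / (\<epsilon> * \<mu>)) * (of_real (1 / (2 * \<epsilon>)) * b + of_real (1 / (2 * \<mu>)) * a)" for a b :: complex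
      unfolding squares using assms(4,5) by (simp add: field_simps power2_eq_square)
    show ?thesis
      unfolding helicity2_def H [abs_def] E [abs_def] time_deriv_mode_sol [OF t rq(1) s]
        time_deriv_mode_sol [OF t rq(2) s] rq(3,4)
        helicity_idft3 [of N L R, OF grid] herm_scale swap
      unfolding mode_sol_def curl_sym_evolve r_def q_def
      by (simp only: weighted_helicity_evolve_conserved [OF assms(4,5), unfolded curl_sym_evolve])
  qed
  show ?thesis
    unfolding h1 h2 [OF assms(6)] h2 [OF order_refl] by simp
qed

end
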